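(* Let $q$ be a prime power and let $s$ be an odd prime with $s\ge q$ and $s\nmid q^2+1$. Let $G$ be an abelian group of order $(q^s+1)(q^{2s}+1)$ and let $D$ be a normalized difference set in $G$ with parameters \[ (v,k,\lambda)=\left((q^s+1)(q^{2s}+1),\,q^{2s}+q^s+1,\,q^s+1\right). \] Let $M$ be a subgroup of $G$ of order $(q+1)(q^2+1)$. Then $D\cap M$ is a normalized difference set in $M$ with parameters $\left((q+1)(q^2+1),\,q^2+q+1,\,q+1\right)$.
   Context: A $(v,k,\lambda)$-difference set in an abelian group $G$ of order $v$ is a $k$-subset $D$ such that every non-identity element of $G$ is of the form $d_1d_2^{-1}$ with $d_1,d_2\in D$ in exactly $\lambda$ ways. It is normalized if $\prod_{d\in D}d=1$. *)

theory Defs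
  imports "HOL-Algebra.Algebra" "HOL-Computational_Algebra.Primes"
begin

definition difference_set :: "('a, 'b) monoid_scheme \<Rightarrow> 'a set \<Rightarrow> nat \<Rightarrow> nat \<Rightarrow> nat \<Rightarrow> bool" where
  "difference_set G D v k lam \<longleftrightarrow>
     card (carrier G) = v \<and> D \<subseteq> carrier G \<and> card D = k \<and>
     (\<forall>g \<in> carrier G - {\<one>\<^bsub>G\<^esub>}.
        card {(d1, d2). d1 \<in> D \<and> d2 \<in> D \<and> d1 \<otimes>\<^bsub>G\<^esub> inv\<^bsub>G\<^esub> d2 = g} = lam)"

definition normalized_difference_set :: "('a, 'b) monoid_scheme \<Rightarrow> 'a set \<Rightarrow> nat \<Rightarrow> nat \<Rightarrow> nat \<Rightarrow> bool" where
  "normalized_difference_set G D v k lam \<longleftrightarrow>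
     difference_set G D v k lam \<and> finprod G (\<lambda>d. d) D = \<one>\<^bsub>G\<^esub>"

definition prime_power :: "nat \<Rightarrow> bool" where
  "prime_power q \<longleftrightarrow> (\<exists>p n. Factorial_Ring.prime (p::nat) \<and> n \<ge> 1 \<and> q = p ^ n)"

end

theory Submission
  imports Defs "HOL-Library.Function_Algebras" "HOL-Number_Theory.Number_Theory"
begin

text \<open>
  Write \<open>Q = q\<^sup>s\<close>. Arithmetic in the integral group ring shows that the prime dividing \<open>q\<close> is a
  multiplier of \<open>D\<close>, and normalization makes \<open>D\<close> invariant under it. Let \<open>A\<close> be any subgroup of order
  \<open>Q + 1\<close>. As \<open>Q\<^sup>2\<close> acts as inversion on \<open>G / A\<close>, the image of \<open>D\<close> in the group ring of \<open>G / A\<close>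
  is determined: \<open>D\<close> contains one coset \<open>xA\<close> and meets every other coset of \<open>A\<close> in a single point.

  The \<open>q\<^sup>4\<close>-th power map has order \<open>s\<close> and preserves \<open>D\<close>. Let \<open>F\<close> be its fixed group,
  which contains \<open>M\<close>, and let \<open>E = D \<inter> F\<close>. The points of \<open>D\<close> in fixed cosets other than \<open>xA\<close> are
  fixed, which gives the size of \<open>E\<close>. For \<open>g \<in> F - A\<close> the number of representations of \<open>g\<close> as a
  quotient from \<open>E\<close> is congruent to \<open>Q + 1\<close>, hence to \<open>q + 1\<close>, modulo \<open>s\<close>; it is at least 2 by the
  coset structure, and therefore at least \<open>q + 1\<close> because \<open>s \<ge> q\<close>. Counting all representations
  forces \<open>F = M\<close> and equality throughout.

  Finally the product over \<open>D - M\<close> is trivial: the \<open>Q\<close>-power map has free orbits of length 4 outside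
  \<open>M \<union> xA\<close>, each with product \<open>d\<close> to the power \<open>1 + Q + Q\<^sup>2 + Q\<^sup>3\<close>, the order of \<open>G\<close>, and inversion pairs off
  the elements of \<open>A - M\<close>.
\<close>

section \<open>Elementary number theory\<close>

lemma fermat_nat:
  assumes "Factorial_Ring.prime (p::nat)"
  shows "[a ^ p = a] (mod p)"
proof (cases "p dvd a")
  case True
  then have "p dvd a ^ p" using assms by (metis dvd_power_same dvd_trans dvd_power prime_gt_0_nat)
  with True show ?thesis by (simp add: cong_def mod_eq_0_iff_dvd)
next
  case False
  have "[a * a ^ (p - 1) = a * 1] (mod p)"
    by (intro cong_mult cong_refl fermat_theorem[OF assms False])
  then show ?thesis
    using prime_gt_0_nat[OF assms] by (simp add: power_eq_if)
qed

lemma fermat_int: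
  assumes "Factorial_Ring.prime (p::nat)"
  shows "[c ^ p = c] (mod int p)"
proof -
  define a where "a = nat (c mod int p)"
  have a: "[c = int a] (mod int p)"
    using prime_gt_0_nat[OF assms] by (simp add: a_def cong_def)
  have "[int a ^ p = int a] (mod int p)"
    using fermat_nat[OF assms, of a] by (metis cong_int_iff of_nat_power)
  then show ?thesis
    using a by (metis cong_pow cong_sym cong_trans)
qed

lemma diff_telescope: "(a - b) + (b - c) = a - (c :: 'a :: ab_group_add)"
  by simp

text \<open>\<open>w\<close> is the alternating sum x^(s-1) - x^(s-2) + ... + 1. Its signs cancel to
  1 modulo x - 1, while modulo x + 1 each of its \<open>s\<close> signed terms becomes 1.\<close>

lemma odd_power_plus_one_int:
  fixes x :: int
  assumes "odd s"
  shows "\<exists>w. x ^ s + 1 = (x + 1) * w \<and> odd w \<and> [w = 1] (mod (x - 1)) \<and> [w = int s] (mod (x + 1))"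
proof -
  have "\<exists>w. x ^ (2 * j + 1) + 1 = (x + 1) * w \<and> odd w \<and> [w = 1] (mod (x - 1)) \<and>
    [w = int (2 * j + 1)] (mod (x + 1))" for j
  proof (induction j)
    case 0
    show ?case by (intro exI[of _ 1]) simp
  next
    case (Suc j)
    then obtain w where w: "x ^ (2 * j + 1) + 1 = (x + 1) * w" "odd w" "[w = 1] (mod (x - 1))"
      "[w = int (2 * j + 1)] (mod (x + 1))" by auto
    \<comment> \<open>The alternating sum prolonged by two terms.\<close>
    define w' where "w' = x\<^sup>2 * w - x + 1"
    have "x ^ (2 * Suc j + 1) + 1 = x\<^sup>2 * (x ^ (2 * j + 1) + 1) - x\<^sup>2 + 1"
      by (simp add: algebra_simps power2_eq_square)
    also have "\<dots> = (x + 1) * w'"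
      unfolding w(1) w'_def by (simp add: algebra_simps power2_eq_square)
    finally have 1: "x ^ (2 * Suc j + 1) + 1 = (x + 1) * w'" .
    have 2: "odd w'" using w(2) by (simp add: w'_def)
    have "w' - w = (x - 1) * ((x + 1) * w - 1)" by (simp add: w'_def algebra_simps power2_eq_square)
    then have "[w' = w] (mod (x - 1))" by (simp add: cong_iff_dvd_diff)
    then have 3: "[w' = 1] (mod (x - 1))" using w(3) by (rule cong_trans)
    have "w' - (w + 2) = (x + 1) * ((x - 1) * w - 1)" by (simp add: w'_def algebra_simps power2_eq_square)
    then have "[w' = w + 2] (mod (x + 1))" by (simp add: cong_iff_dvd_diff)
    moreover have "[w + 2 = int (2 * j + 1) + 2] (mod (x + 1))"
      using w(4) by (intro cong_add cong_refl)
    ultimately have 4: "[w' = int (2 * Suc j + 1)] (mod (x + 1))"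
      using cong_trans by fastforce
    show ?case using 1 2 3 4 by blast
  qed
  moreover obtain j where "s = 2 * j + 1" using assms by (rule oddE)
  ultimately show ?thesis by blast
qed

lemma odd_power_plus_one:
  fixes x :: nat
  assumes "odd s" "x > 0"
  obtains w where "x ^ s + 1 = (x + 1) * w" "odd w" "coprime w (x - 1)" "[w = s] (mod (x + 1))"
proof -
  obtain w where w: "int x ^ s + 1 = (int x + 1) * w" "odd w" "[w = 1] (mod (int x - 1))"
    "[w = int s] (mod (int x + 1))" using odd_power_plus_one_int[OF assms(1)] by blast
  have "(int x + 1) * w > 0" unfolding w(1)[symmetric] by (simp add: add_nonneg_pos)
  then have "w > 0" by (simp add: zero_less_mult_iff)
  then obtain u where u: "w = int u" by (metis zero_less_imp_eq_int)
  have "int (x ^ s + 1) = int ((x + 1) * u)" using w(1) by (simp add: u algebra_simps)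
  then have 1: "x ^ s + 1 = (x + 1) * u" by (simp only: of_nat_eq_iff)
  have 2: "odd u" using w(2) u by simp
  have "[int u = int 1] (mod int (x - 1))" using w(3) u assms(2) by (simp add: of_nat_diff)
  then have "[u = 1] (mod (x - 1))" by (simp only: cong_int_iff)
  then have 3: "coprime u (x - 1)" by (metis cong_imp_coprime cong_sym coprime_1_left)
  have "[int u = int s] (mod int (x + 1))" using w(4) u by (simp add: add.commute)
  then have 4: "[u = s] (mod (x + 1))" by (simp only: cong_int_iff)
  show thesis using that 1 2 3 4 by blast
qed

lemma minus_one_dvd_power_minus_one: "x > 0 \<Longrightarrow> (x - 1 :: nat) dvd x ^ n - 1"
proof (induction n)
  case (Suc n)
  obtain y where y: "x ^ n = Suc y" using Suc.prems gr0_conv_Suc by (metis zero_less_power)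
  have "x ^ Suc n - 1 = x * (x ^ n - 1) + (x - 1)" using Suc.prems by (simp add: y)
  then show ?case using Suc by (metis dvd_add dvd_mult dvd_refl)
qed simp

text \<open>In the application \<open>a\<close> is the order of \<open>A \<inter> F\<close> and
  \<open>b\<close> is |F| / a. Cancelling b - 1 leaves a(q - 1) \<le> b - 2 \<le> q^2 - 1, so a
  \<le> q + 1; the lower bound on a b gives the reverse inequality, and then \<open>b\<close> is
  forced too.\<close>

lemma count_bound:
  fixes a b q :: nat
  assumes "q \<ge> 2" "b \<le> q\<^sup>2 + 1" "b \<ge> 2" "(q + 1) * (q\<^sup>2 + 1) \<le> a * b"
    and "(b - 1) * (a * (q + 1)) \<le> (b - 1) * (2 * a + b - 2)"
  shows "a = q + 1" "b = q\<^sup>2 + 1"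
proof -
  have "a * (q + 1) \<le> 2 * a + b - 2" using assms(3,5) by simp
  then have 1: "int a * (int q + 1) \<le> 2 * int a + int b - 2"
    using assms(3) by (metis (no_types, lifting) of_nat_1 of_nat_add of_nat_diff of_nat_le_iff
        of_nat_mult of_nat_numeral trans_le_add2)
  have "(q + 1) * b \<le> (q + 1) * (q\<^sup>2 + 1)" using assms(2) by (rule mult_le_mono2)
  then have "(q + 1) * b \<le> a * b" using assms(4) by (rule le_trans)
  then have a: "q + 1 \<le> a" by (rule mult_right_le_imp_le) (use assms(3) in simp)
  have "(int q + 1) * (int q - 1) \<le> int a * (int q - 1)"
    using a assms(1) by (intro mult_right_mono) auto
  then have "int (q\<^sup>2 + 1) \<le> int b"
    using 1 by (simp add: power2_eq_square algebra_simps)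
  then have "q\<^sup>2 + 1 \<le> b" by (simp only: of_nat_le_iff)
  then show b: "b = q\<^sup>2 + 1" using assms(2) by simp
  have "int a * (int q - 1) \<le> (int q + 1) * (int q - 1)"
    using 1 unfolding b by (simp add: power2_eq_square algebra_simps)
  then have "int a \<le> int q + 1" using assms(1) by (simp add: mult_le_cancel_right)
  then show "a = q + 1" using a by simp
qed

section \<open>Orbits of periodic maps\<close>

lemma funpow_mult_fixed: "(f ^^ a) y = y \<Longrightarrow> (f ^^ (a * n)) y = y"
  by (induction n) (auto simp: funpow_add)

lemma funpow_gcd_fixed:
  assumes "(f ^^ a) y = y" "(f ^^ b) y = y"
  shows "(f ^^ gcd a b) y = y"
proof (cases "a = 0")
  case False
  then obtain m n where mn: "a * m = b * n + gcd a b" using bezout_nat by blast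
  have "y = (f ^^ (gcd a b + b * n)) y"
    using funpow_mult_fixed[OF assms(1), of m] mn by (simp add: add.commute)
  also have "\<dots> = (f ^^ gcd a b) y"
    by (simp only: funpow_add o_apply funpow_mult_fixed[OF assms(2)])
  finally show ?thesis ..
qed (use assms in auto)

text \<open>If the iterates \<open>i < j\<close> agreed, applying \<open>f\<close> another
  \<open>k - j\<close> times would give a return to \<open>y\<close> after \<open>k - j + i\<close>
  steps, a number strictly between 0 and \<open>k\<close>.\<close>

lemma inj_on_orbit:
  assumes "(f ^^ k) y = y" "\<And>i. 0 < i \<Longrightarrow> i < k \<Longrightarrow> (f ^^ i) y \<noteq> y"
  shows "inj_on (\<lambda>i. (f ^^ i) y) {..<k}"
proof -
  have neq: "(f ^^ i) y \<noteq> (f ^^ j) y" if "i < j" "j < k" for i j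
  proof
    assume eq: "(f ^^ i) y = (f ^^ j) y"
    have "(f ^^ (k - j + i)) y = (f ^^ (k - j + j)) y"
      by (simp only: funpow_add o_apply eq)
    also have "\<dots> = y" using assms(1) that by simp
    finally have "(f ^^ (k - j + i)) y = y" .
    moreover have "(f ^^ (k - j + i)) y \<noteq> y" using that by (intro assms(2)) auto
    ultimately show False by contradiction
  qed
  show ?thesis
  proof (rule inj_onI)
    fix i j assume "i \<in> {..<k}" "j \<in> {..<k}" "(f ^^ i) y = (f ^^ j) y"
    then show "i = j"
      using neq[of i j] neq[of j i] by (cases i j rule: linorder_cases) simp_all
  qed
qed

text \<open>Cycles are removed one at a time. A cycle is written over the indices
  \<open>{..<k}\<close> without asking for injectivity, so the same induction serves cardinalities
  and products, each adding freeness where it needs it.\<close>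

lemma free_orbit_induct:
  assumes "finite S" and f: "\<And>y. y \<in> S \<Longrightarrow> f y \<in> S"
    and per: "\<And>y. y \<in> S \<Longrightarrow> (f ^^ k) y = y"
    and "k > 0"
    and "P {}"
    and step: "\<And>y T. y \<in> S \<Longrightarrow> T \<subseteq> S \<Longrightarrow> (\<lambda>i. (f ^^ i) y) ` {..<k} \<subseteq> S \<Longrightarrow>
      (\<lambda>i. (f ^^ i) y) ` {..<k} \<inter> T = {} \<Longrightarrow> P T \<Longrightarrow> P ((\<lambda>i. (f ^^ i) y) ` {..<k} \<union> T)"
  shows "P S"
proof -
  have "P T" if "finite T" "T \<subseteq> S" "\<And>y. y \<in> T \<Longrightarrow> f y \<in> T" for T
    using that
  proof (induction T rule: finite_psubset_induct)
    case (psubset T)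
    show ?case
    proof (cases "T = {}")
      case False
      then obtain y where y: "y \<in> T" by auto
      define Orb where "Orb = (\<lambda>i. (f ^^ i) y) ` {..<k}"
      have iter: "(f ^^ i) y \<in> T" for i
        using y psubset.prems by (induction i) auto
      have OT: "Orb \<subseteq> T" using iter by (auto simp: Orb_def)
      have "y \<in> Orb" using \<open>k > 0\<close> by (auto simp: Orb_def intro!: image_eqI[of _ _ 0])
      have fO: "f z \<in> Orb" if "z \<in> Orb" for z
      proof -
        obtain i where i: "z = (f ^^ i) y" "i < k" using \<open>z \<in> Orb\<close> by (auto simp: Orb_def)
        show ?thesis
        proof (cases "Suc i = k")
          case True
          then have "f z = y" using per[of y] y psubset.prems(1) i(1) by auto
          then show ?thesis using \<open>y \<in> Orb\<close> by simp
        next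
          case False
          then show ?thesis using i by (auto simp: Orb_def intro!: image_eqI[of _ _ "Suc i"])
        qed
      qed
      \<comment> \<open>The complement of a cycle is invariant as well: \<open>f\<close> is undone
        by \<open>f ^^ (k - 1)\<close>, so a point whose image lies in the cycle was already in
        it.\<close>
      have "f z \<in> T - Orb" if z: "z \<in> T - Orb" for z
      proof -
        have "f z \<notin> Orb"
        proof
          assume "f z \<in> Orb"
          then have "(f ^^ n) (f z) \<in> Orb" for n using fO by (induction n) auto
          then have "(f ^^ (k - 1)) (f z) \<in> Orb" .
          moreover have "(f ^^ (k - 1)) (f z) = (f ^^ k) z"
            using \<open>k > 0\<close> by (cases k) (auto simp: funpow_swap1)
          ultimately show False using per[of z] z psubset.prems(1) by auto
        qed
        then show ?thesis using z psubset.prems(2) by auto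
      qed
      then have "P (T - Orb)"
        using psubset.prems(1) y \<open>y \<in> Orb\<close> by (intro psubset.IH) auto
      then have "P (Orb \<union> (T - Orb))"
        unfolding Orb_def
        by (intro step) (use y psubset.prems OT in \<open>auto simp: Orb_def\<close>)
      then show ?thesis using OT by (simp add: Un_absorb1)
    qed (simp add: \<open>P {}\<close>)
  qed
  from this[of S] show ?thesis using \<open>finite S\<close> f by auto
qed

lemma card_dvd_free_orbits:
  assumes "finite S" "\<And>y. y \<in> S \<Longrightarrow> f y \<in> S" "\<And>y. y \<in> S \<Longrightarrow> (f ^^ k) y = y" "k > 0"
    and inj: "\<And>y. y \<in> S \<Longrightarrow> inj_on (\<lambda>i. (f ^^ i) y) {..<k}"
  shows "k dvd card S"
proof (rule free_orbit_induct[OF assms(1-4), where P = "\<lambda>S. k dvd card S"])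
  fix y T
  assume orbit: "y \<in> S" "T \<subseteq> S" "(\<lambda>i. (f ^^ i) y) ` {..<k} \<subseteq> S"
    "(\<lambda>i. (f ^^ i) y) ` {..<k} \<inter> T = {}" "k dvd card T"
  have "finite T" using orbit(2) assms(1) by (rule finite_subset)
  then show "k dvd card ((\<lambda>i. (f ^^ i) y) ` {..<k} \<union> T)"
    using orbit inj[of y] by (subst card_Un_disjoint) (auto simp: card_image)
qed simp_all

text \<open>A cyclic group of prime order acts, so each point that is not fixed lies in an orbit of
  exactly \<open>s\<close> points.\<close>

lemma card_fixed_points_cong:
  assumes s: "Factorial_Ring.prime (s::nat)"
    and S: "finite S" "\<And>y. y \<in> S \<Longrightarrow> f y \<in> S" "\<And>y. y \<in> S \<Longrightarrow> (f ^^ s) y = y"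
  shows "[card S = card {y \<in> S. f y = y}] (mod s)"
proof -
  define T where "T = {y \<in> S. f y \<noteq> y}"
  have s0: "s > 0" using s by (rule prime_gt_0_nat)
  have "s dvd card T"
  proof (rule card_dvd_free_orbits[where f = f])
    fix y assume y: "y \<in> T"
    show "f y \<in> T"
    proof -
      have "f (f y) \<noteq> f y"
      proof
        assume "f (f y) = f y"
        then have "(f ^^ n) (f y) = f y" for n by (induction n) auto
        then have "(f ^^ s) y = f y" using s0 by (cases s) (auto simp: funpow_swap1)
        then show False using S(3)[of y] y by (auto simp: T_def)
      qed
      then show ?thesis using y S(2) by (auto simp: T_def)
    qed
    show per: "(f ^^ s) y = y" using S(3) y by (auto simp: T_def)
    show "inj_on (\<lambda>i. (f ^^ i) y) {..<s}"
    proof (rule inj_on_orbit[OF per])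
      fix i assume i: "0 < i" "i < s"
      show "(f ^^ i) y \<noteq> y"
      proof
        assume "(f ^^ i) y = y"
        then have "(f ^^ gcd i s) y = y" using per by (rule funpow_gcd_fixed)
        moreover have "coprime i s"
          using i s by (metis coprime_commute nat_dvd_not_less prime_imp_coprime)
        ultimately show False using y by (auto simp: T_def)
      qed
    qed
  qed (use S s0 in \<open>auto simp: T_def\<close>)
  moreover have "card S = card {y \<in> S. f y = y} + card T"
    using S(1) by (subst card_Un_disjoint[symmetric]) (auto simp: T_def intro!: arg_cong[where f = card])
  ultimately show ?thesis by (simp add: cong_def mod_add_right_eq[symmetric] dvd_eq_mod_eq_0)
qed

text \<open>Every non-trivial subgroup of a cyclic group of order 4 contains the element of order 2.
  This detects orbits of length below 4.\<close>

lemma funpow_four_fixed: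
  assumes "(f ^^ 4) y = y" "(f ^^ i) y = y" "0 < i" "i < 4"
  shows "(f ^^ 2) y = y"
proof -
  have four: "f (f (f (f y))) = y" using assms(1) by (simp add: numeral_eq_Suc)
  have "i = 1 \<or> i = 2 \<or> i = 3" using assms(3,4) by auto
  then have "f y = y \<or> f (f y) = y \<or> f (f (f y)) = y"
    using assms(2) by (auto simp: numeral_eq_Suc)
  then have "f (f y) = y" using four by metis
  then show ?thesis by (simp add: numeral_eq_Suc)
qed

section \<open>The integral group ring of a finite abelian group\<close>

locale finite_comm_group = comm_group G for G (structure) +
  assumes finite_carrier [simp]: "finite (carrier G)"
begin

text \<open>Product of the integral group ring. Elements are functions on the whole type and the
  product vanishes off the carrier, so that ring identities become equalities of functions. The
  product \<open>*\<close> of functions stays pointwise; scalars are constant functions.\<close>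

definition conv :: "('a \<Rightarrow> int) \<Rightarrow> ('a \<Rightarrow> int) \<Rightarrow> 'a \<Rightarrow> int" (infixl "\<star>" 70) where
  "f \<star> h = (\<lambda>u. if u \<in> carrier G then \<Sum>x\<in>carrier G. f x * h (inv x \<otimes> u) else 0)"

definition delta :: "'a \<Rightarrow> 'a \<Rightarrow> int" where
  "delta g = (\<lambda>u. if u = g then 1 else 0)"

definition on_group :: "('a \<Rightarrow> int) \<Rightarrow> bool" where
  "on_group f \<longleftrightarrow> (\<forall>x. x \<notin> carrier G \<longrightarrow> f x = 0)"

text \<open>The iteration starts at \<open>delta \<one>\<close>, so the first power of
  \<open>f\<close> is \<open>f\<close> itself only when \<open>f\<close> is supported on the
  group.\<close>

definition cpow :: "('a \<Rightarrow> int) \<Rightarrow> nat \<Rightarrow> 'a \<Rightarrow> int" where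
  "cpow f n = ((\<star>) f ^^ n) (delta \<one>)"

text \<open>A pullback along the power map. If \<open>l\<close> inverts \<open>p\<close> modulo the
  group order, \<open>twist l\<close> is therefore the ring automorphism induced by g ->
  g^p.\<close>

definition twist :: "nat \<Rightarrow> ('a \<Rightarrow> int) \<Rightarrow> 'a \<Rightarrow> int" where
  "twist k f = (\<lambda>u. if u \<in> carrier G then f (u [^] k) else 0)"

lemma inv_cancel_left [simp]:
  assumes "x \<in> carrier G" "y \<in> carrier G"
  shows "inv x \<otimes> (x \<otimes> y) = y" "x \<otimes> (inv x \<otimes> y) = y"
  using assms by (simp_all add: m_assoc [symmetric])

lemma conv_comm: "f \<star> h = h \<star> f"
proof
  fix u
  show "(f \<star> h) u = (h \<star> f) u"
  proof (cases "u \<in> carrier G")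
    case True
    have "(\<Sum>x\<in>carrier G. f x * h (inv x \<otimes> u)) = (\<Sum>x\<in>carrier G. h x * f (inv x \<otimes> u))"
      using True
      by (intro sum.reindex_bij_witness[where i = "\<lambda>y. inv y \<otimes> u" and j = "\<lambda>y. inv y \<otimes> u"])
         (auto simp: inv_mult m_assoc m_comm[of _ u])
    then show ?thesis by (simp add: conv_def)
  qed (simp add: conv_def)
qed

lemma conv_assoc: "f \<star> g \<star> h = f \<star> (g \<star> h)"
proof
  fix u
  show "(f \<star> g \<star> h) u = (f \<star> (g \<star> h)) u"
  proof (cases "u \<in> carrier G")
    case True
    have "(f \<star> g \<star> h) u = (\<Sum>x\<in>carrier G. \<Sum>y\<in>carrier G. f y * (g (inv y \<otimes> x) * h (inv x \<otimes> u)))"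
      using True by (simp add: conv_def sum_distrib_right mult.assoc)
    also have "\<dots> = (\<Sum>y\<in>carrier G. f y * (\<Sum>x\<in>carrier G. g (inv y \<otimes> x) * h (inv x \<otimes> u)))"
      by (subst sum.swap) (simp add: sum_distrib_left)
    also have "\<dots> = (\<Sum>y\<in>carrier G. f y * (\<Sum>x\<in>carrier G. g x * h (inv x \<otimes> (inv y \<otimes> u))))"
    proof (rule sum.cong [OF refl])
      fix y assume y: "y \<in> carrier G"
      have "(\<Sum>x\<in>carrier G. g (inv y \<otimes> x) * h (inv x \<otimes> u)) =
            (\<Sum>x\<in>carrier G. g x * h (inv x \<otimes> (inv y \<otimes> u)))"
        using True y
        by (intro sum.reindex_bij_witness[where i = "\<lambda>x. y \<otimes> x" and j = "\<lambda>x. inv y \<otimes> x"])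
           (auto simp: inv_mult_group m_assoc)
      then show "f y * (\<Sum>x\<in>carrier G. g (inv y \<otimes> x) * h (inv x \<otimes> u)) =
            f y * (\<Sum>x\<in>carrier G. g x * h (inv x \<otimes> (inv y \<otimes> u)))" by simp
    qed
    also have "\<dots> = (f \<star> (g \<star> h)) u"
      using True by (simp add: conv_def)
    finally show ?thesis .
  qed (simp add: conv_def)
qed

lemma conv_left_comm: "f \<star> (g \<star> h) = g \<star> (f \<star> h)"
  by (metis conv_assoc conv_comm)

lemmas conv_ac = conv_assoc conv_comm conv_left_comm

lemma conv_add_right: "f \<star> (g + h) = f \<star> g + f \<star> h"
  by (auto simp: conv_def fun_eq_iff sum.distrib algebra_simps)

lemma conv_diff_right: "f \<star> (g - h) = f \<star> g - f \<star> h"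
  by (auto simp: conv_def fun_eq_iff sum_subtractf algebra_simps)

lemma conv_zero_right [simp]: "f \<star> 0 = 0"
  by (auto simp: conv_def fun_eq_iff)

lemma conv_const_right: "f \<star> ((\<lambda>_. c) * g) = (\<lambda>_. c) * (f \<star> g)"
  by (auto simp: conv_def fun_eq_iff sum_distrib_left algebra_simps)

lemma conv_add_left: "(g + h) \<star> f = g \<star> f + h \<star> f"
  by (metis conv_add_right conv_comm)

lemma conv_diff_left: "(g - h) \<star> f = g \<star> f - h \<star> f"
  by (metis conv_diff_right conv_comm)

lemma conv_zero_left [simp]: "0 \<star> f = 0"
  by (metis conv_zero_right conv_comm)

lemma conv_const_left: "((\<lambda>_. c) * g) \<star> f = (\<lambda>_. c) * (g \<star> f)"
  by (metis conv_const_right conv_comm)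

lemma conv_of_nat_right: "f \<star> (of_nat c * g) = of_nat c * (f \<star> g)"
  by (simp add: of_nat_fun conv_const_right)

lemma conv_of_nat_left: "(of_nat c * g) \<star> f = of_nat c * (g \<star> f)"
  by (simp add: of_nat_fun conv_const_left)

lemma conv_sum_right:
  "(f \<star> (\<lambda>u. \<Sum>i\<in>I. c i * g i u)) x = (\<Sum>i\<in>I. c i * (f \<star> g i) x)"
proof (cases "x \<in> carrier G")
  case True
  then have "(f \<star> (\<lambda>u. \<Sum>i\<in>I. c i * g i u)) x =
      (\<Sum>y\<in>carrier G. \<Sum>i\<in>I. c i * (f y * g i (inv y \<otimes> x)))"
    by (simp add: conv_def sum_distrib_left mult.left_commute)
  also have "\<dots> = (\<Sum>i\<in>I. c i * (f \<star> g i) x)"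
    using True by (subst sum.swap) (simp add: conv_def sum_distrib_left)
  finally show ?thesis .
qed (simp add: conv_def)

text \<open>\<open>of_nat m\<close> is a constant function and divisibility refers to the pointwise
  ring; congruences modulo \<open>m\<close> in the group ring are written in this way
  throughout.\<close>

lemma of_nat_dvd_fun_iff: "of_nat m dvd f \<longleftrightarrow> (\<forall>x. int m dvd f x)"
  for f :: "'c \<Rightarrow> int"
proof
  assume "\<forall>x. int m dvd f x"
  then have "f = of_nat m * (\<lambda>x. f x div int m)"
    by (intro ext) (simp add: of_nat_fun)
  then show "of_nat m dvd f" by (rule dvdI)
qed (auto simp: dvd_def)

lemma dvd_conv_right: "of_nat c dvd g \<Longrightarrow> of_nat c dvd f \<star> g"
  by (auto simp: dvd_def conv_of_nat_right)

lemma dvd_conv_left: "of_nat c dvd g \<Longrightarrow> of_nat c dvd g \<star> f"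
  by (auto simp: dvd_def conv_of_nat_left)

lemma on_group_conv [simp]: "on_group (f \<star> g)"
  by (simp add: on_group_def conv_def)

lemma conv_delta_left:
  assumes "g \<in> carrier G" "u \<in> carrier G"
  shows "(delta g \<star> f) u = f (inv g \<otimes> u)"
proof -
  have "(delta g \<star> f) u = (\<Sum>x\<in>carrier G. if x = g then f (inv x \<otimes> u) else 0)"
  proof -
    have "(delta g \<star> f) u = (\<Sum>x\<in>carrier G. delta g x * f (inv x \<otimes> u))"
      using assms by (simp add: conv_def)
    also have "\<dots> = (\<Sum>x\<in>carrier G. if x = g then f (inv x \<otimes> u) else 0)"
      by (intro sum.cong refl) (simp add: delta_def)
    finally show ?thesis .
  qed
  then show ?thesis using assms by simp
qed

lemma conv_one_left [simp]: "on_group f \<Longrightarrow> delta \<one> \<star> f = f"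
  by (rule ext, rename_tac u, case_tac "u \<in> carrier G")
     (simp_all add: conv_delta_left, simp add: conv_def on_group_def)

lemma conv_one_right [simp]: "on_group f \<Longrightarrow> f \<star> delta \<one> = f"
  by (metis conv_comm conv_one_left)

lemma conv_delta_delta:
  assumes "g \<in> carrier G" "h \<in> carrier G"
  shows "delta g \<star> delta h = delta (g \<otimes> h)"
proof
  fix u show "(delta g \<star> delta h) u = delta (g \<otimes> h) u"
  proof (cases "u \<in> carrier G")
    case True
    then have "(delta g \<star> delta h) u = delta h (inv g \<otimes> u)"
      using assms by (simp add: conv_delta_left)
    then show ?thesis using True assms
      by (auto simp: delta_def)
  next
    case False
    then have "u \<noteq> g \<otimes> h" using assms by auto
    with False show ?thesis by (simp add: conv_def delta_def)
  qed
qed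

lemma on_group_delta [simp]: "g \<in> carrier G \<Longrightarrow> on_group (delta g)"
  by (auto simp: on_group_def delta_def)

lemma on_group_diff [simp]: "on_group f \<Longrightarrow> on_group g \<Longrightarrow> on_group (f - g)"
  by (simp add: on_group_def)

section \<open>Convolution powers and the binomial theorem\<close>

lemma cpow_0 [simp]: "cpow f 0 = delta \<one>"
  by (simp add: cpow_def)

lemma cpow_Suc [simp]: "cpow f (Suc n) = f \<star> cpow f n"
  by (simp add: cpow_def)

lemma on_group_cpow [simp]: "on_group (cpow f n)"
  by (cases n) auto

lemma cpow_1: "on_group f \<Longrightarrow> cpow f (Suc 0) = f"
  by simp

lemma cpow_add: "cpow f (m + n) = cpow f m \<star> cpow f n"
  by (induction m) (auto simp: conv_assoc)

lemma cpow_mult: "cpow f (m * n) = cpow (cpow f m) n"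
  by (induction n) (auto simp: cpow_add)

lemma cpow_delta:
  "g \<in> carrier G \<Longrightarrow> cpow ((\<lambda>_. c) * delta g) n = (\<lambda>_. c ^ n) * delta (g [^] n)"
proof (induction n)
  case 0
  then show ?case by (auto simp: delta_def fun_eq_iff)
next
  case (Suc n)
  have "cpow ((\<lambda>_. c) * delta g) (Suc n)
      = ((\<lambda>_. c) * delta g) \<star> ((\<lambda>_. c ^ n) * delta (g [^] n))"
    by (simp only: cpow_Suc Suc.IH[OF Suc.prems])
  also have "\<dots> = (\<lambda>_. c) * ((\<lambda>_. c ^ n) * (delta g \<star> delta (g [^] n)))"
    by (subst conv_const_left, subst conv_const_right) (rule refl)
  also have "delta g \<star> delta (g [^] n) = delta (g [^] Suc n)"
    using Suc.prems by (simp only: conv_delta_delta nat_pow_closed nat_pow_Suc2)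
  finally show ?case by (simp add: fun_eq_iff)
qed

lemma cpow_binomial:
  "cpow (a + b) n u = (\<Sum>k\<le>n. int (n choose k) * (cpow a k \<star> cpow b (n - k)) u)"
proof (induction n arbitrary: u)
  case 0
  then show ?case by (simp add: conv_delta_delta)
next
  case (Suc n)
  define T where "T k = (cpow a k \<star> cpow b (Suc n - k)) u" for k
  have split: "((a + b) \<star> (cpow a k \<star> cpow b (n - k))) u = T (Suc k) + T k" if "k \<le> n" for k
  proof -
    have "(a + b) \<star> (cpow a k \<star> cpow b (n - k))
        = cpow a (Suc k) \<star> cpow b (n - k) + cpow a k \<star> cpow b (Suc (n - k))"
      unfolding cpow_Suc conv_add_left conv_assoc conv_left_comm[of b "cpow a k"] ..
    with that show ?thesis
      by (simp only: T_def plus_fun_apply diff_Suc_Suc Suc_diff_le)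
  qed
  have "cpow (a + b) (Suc n) u
      = ((a + b) \<star> (\<lambda>u. \<Sum>k\<le>n. int (n choose k) * (cpow a k \<star> cpow b (n - k)) u)) u"
    by (simp only: cpow_Suc Suc.IH ext[of "cpow (a + b) n"])
  also have "\<dots> = (\<Sum>k\<le>n. int (n choose k) * T (Suc k)) + (\<Sum>k\<le>n. int (n choose k) * T k)"
  proof -
    have "(\<Sum>k\<le>n. int (n choose k) * ((a + b) \<star> (cpow a k \<star> cpow b (n - k))) u)
        = (\<Sum>k\<le>n. int (n choose k) * (T (Suc k) + T k))"
      by (intro sum.cong refl) (simp only: split atMost_iff)
    then show ?thesis by (simp only: conv_sum_right distrib_left sum.distrib)
  qed
  \<comment> \<open>The added term vanishes because \<open>n choose Suc n\<close> is 0; with equal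
    ranges the two sums combine by Pascal's rule.\<close>
  also have "(\<Sum>k\<le>n. int (n choose k) * T k) = (\<Sum>k\<le>Suc n. int (n choose k) * T k)"
    by simp
  also have "\<dots> = T 0 + (\<Sum>k\<le>n. int (n choose Suc k) * T (Suc k))"
    by (subst sum.atMost_Suc_shift) simp
  also have "(\<Sum>k\<le>n. int (n choose k) * T (Suc k)) + \<dots>
      = T 0 + (\<Sum>k\<le>n. int (Suc n choose Suc k) * T (Suc k))"
    by (simp add: distrib_right sum.distrib)
  also have "\<dots> = (\<Sum>k\<le>Suc n. int (Suc n choose k) * T k)"
    by (subst sum.atMost_Suc_shift) simp
  finally show ?case by (simp only: T_def)
qed

text \<open>The inner binomial coefficients are divisible by \<open>p\<close>, so the
  \<open>p\<close>-th power is additive modulo \<open>p\<close>.\<close>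

lemma cpow_add_prime:
  assumes "Factorial_Ring.prime (p::nat)"
  shows "of_nat p dvd cpow (a + b) p - (cpow a p + cpow b p)"
  unfolding of_nat_dvd_fun_iff
proof
  fix u
  have p: "p > 0" using assms by (simp add: prime_gt_0_nat)
  let ?f = "\<lambda>k. int (p choose k) * (cpow a k \<star> cpow b (p - k)) u"
  have dec: "{..p} = insert 0 (insert p {1..<p})" using p by auto
  have "sum ?f {..p} = ?f 0 + (?f p + sum ?f {1..<p})"
    unfolding dec using p by simp
  then have "(cpow (a + b) p - (cpow a p + cpow b p)) u = sum ?f {1..<p}"
    by (simp add: cpow_binomial)
  moreover have "int p dvd sum ?f {1..<p}"
    using assms by (intro dvd_sum dvd_mult2) (auto intro!: dvd_choose_prime)
  ultimately show "int p dvd (cpow (a + b) p - (cpow a p + cpow b p)) u" by simp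
qed

section \<open>Twists by power maps and the Frobenius congruence\<close>

lemma twist_add: "twist k (f + g) = twist k f + twist k g"
  by (auto simp: twist_def fun_eq_iff)

lemma twist_diff: "twist k (f - g) = twist k f - twist k g"
  by (auto simp: twist_def fun_eq_iff)

lemma twist_of_nat: "twist k (of_nat c * f) = of_nat c * twist k f"
  by (auto simp: twist_def fun_eq_iff)

lemma twist_const: "twist k ((\<lambda>_. c) * f) = (\<lambda>_. c) * twist k f"
  by (auto simp: twist_def fun_eq_iff)

lemma on_group_twist [simp]: "on_group (twist k f)"
  by (auto simp: twist_def on_group_def)

lemma dvd_twist: "of_nat c dvd f \<Longrightarrow> of_nat c dvd twist k f"
  by (auto simp: dvd_def twist_of_nat)

lemma twist_twist: "twist k (twist l f) = twist (k * l) f"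
  by (auto simp: twist_def fun_eq_iff nat_pow_pow mult.commute)

lemma pow_mod_order:
  assumes "x \<in> carrier G"
  shows "x [^] (k mod order G) = x [^] (k::nat)"
proof -
  have "x [^] k = x [^] (order G * (k div order G)) \<otimes> x [^] (k mod order G)"
    using assms by (simp add: nat_pow_mult)
  also have "x [^] (order G * (k div order G)) = \<one>"
    using assms by (simp add: nat_pow_pow[symmetric] pow_order_eq_1)
  finally show ?thesis using assms by simp
qed

lemma pow_cong_order:
  assumes "x \<in> carrier G" "[k = l] (mod order G)"
  shows "x [^] k = x [^] l"
  using assms pow_mod_order by (metis cong_def)

lemma twist_cong: "[k = l] (mod order G) \<Longrightarrow> twist k f = twist l f"
  by (auto simp: twist_def fun_eq_iff pow_cong_order)

lemma twist_1: "on_group f \<Longrightarrow> twist (Suc 0) f = f"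
  by (auto simp: twist_def on_group_def fun_eq_iff)

lemma pow_pow_inverse:
  assumes "[k * l = 1] (mod order G)" "x \<in> carrier G"
  shows "(x [^] k) [^] l = x"
  using assms pow_cong_order[of x "k * l" 1] by (simp add: nat_pow_pow)

text \<open>Invertibility of \<open>k\<close> makes the power map a permutation of the group, so the
  convolution sum can be reindexed along it.\<close>

lemma twist_conv:
  assumes "[k * l = 1] (mod order G)"
  shows "twist k (f \<star> g) = twist k f \<star> twist k g"
proof
  fix u
  have l: "[l * k = 1] (mod order G)" using assms by (simp add: mult.commute)
  show "twist k (f \<star> g) u = (twist k f \<star> twist k g) u"
  proof (cases "u \<in> carrier G")
    case True
    have "(\<Sum>x\<in>carrier G. f x * g (inv x \<otimes> u [^] k)) =
          (\<Sum>x\<in>carrier G. f (x [^] k) * g ((inv x \<otimes> u) [^] k))"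
      using True pow_pow_inverse[OF assms] pow_pow_inverse[OF l]
      by (intro sum.reindex_bij_witness[where i = "\<lambda>x. x [^] k" and j = "\<lambda>x. x [^] l"])
         (auto simp: pow_mult_distrib m_comm nat_pow_inv)
    with True show ?thesis
      by (simp add: twist_def conv_def)
  qed (simp add: twist_def conv_def)
qed

lemma twist_delta:
  assumes "[k * l = 1] (mod order G)" "g \<in> carrier G"
  shows "twist k (delta g) = delta (g [^] l)"
proof -
  have l: "[l * k = 1] (mod order G)" using assms by (simp add: mult.commute)
  show ?thesis
    using assms(2) pow_pow_inverse[OF assms(1)] pow_pow_inverse[OF l]
    by (auto simp: twist_def delta_def fun_eq_iff)
qed

lemma twist_one:
  assumes "[k * l = 1] (mod order G)"
  shows "twist k (delta \<one>) = delta \<one>"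
  using twist_delta[OF assms, of \<one>] by simp

lemma twist_cpow:
  assumes "[k * l = 1] (mod order G)"
  shows "twist k (cpow f n) = cpow (twist k f) n"
  by (induction n) (simp_all add: twist_one[OF assms] twist_conv[OF assms])

text \<open>Additivity of the \<open>p\<close>-th power modulo \<open>p\<close> reduces the claim,
  by induction on the support, to one term c g. There the power is c^p g^p, and Fermat replaces c^p
  by c.\<close>

theorem cpow_prime_cong:
  assumes p: "Factorial_Ring.prime (p::nat)" and l: "[l * p = 1] (mod order G)"
    and f: "on_group f"
  shows "of_nat p dvd cpow f p - twist l f"
proof -
  have "of_nat p dvd cpow f p - twist l f"
    if "finite S" "S \<subseteq> carrier G" "\<And>x. x \<notin> S \<Longrightarrow> f x = 0" for S f
    using that
  proof (induction S arbitrary: f rule: finite_induct)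
    case empty
    then have f0: "f = 0" by (auto simp: fun_eq_iff)
    have "cpow f p = 0" using p by (cases p) (auto simp: f0)
    moreover have "twist l f = 0" by (auto simp: twist_def f0 fun_eq_iff)
    ultimately show ?case by (simp only: diff_self dvd_0_right)
  next
    case (insert g S)
    define a where "a = f(g := 0)"
    define b where "b = (\<lambda>_. f g) * delta g"
    have g: "g \<in> carrier G" using insert.prems by auto
    have fab: "f = a + b" by (auto simp: a_def b_def delta_def fun_eq_iff)
    have "of_nat p dvd cpow f p - (cpow a p + cpow b p)"
      unfolding fab by (rule cpow_add_prime[OF p])
    moreover have "of_nat p dvd cpow a p - twist l a"
      using insert.prems insert.hyps by (intro insert.IH) (auto simp: a_def)
    moreover have "of_nat p dvd cpow b p - twist l b"
    proof -
      have tb: "twist l b = (\<lambda>_. f g) * delta (g [^] p)"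
        by (simp only: b_def twist_const twist_delta[OF l g])
      have "[f g ^ p = f g] (mod int p)"
        by (rule fermat_int[OF p])
      then have "int p dvd f g ^ p - f g" by (simp add: cong_iff_dvd_diff)
      then show ?thesis
        unfolding tb unfolding b_def cpow_delta[OF g] of_nat_dvd_fun_iff
        by (auto simp: left_diff_distrib[symmetric])
    qed
    ultimately have "of_nat p dvd (cpow f p - (cpow a p + cpow b p)) + (cpow a p - twist l a)
         + (cpow b p - twist l b)"
      by (intro dvd_add)
    also have "\<dots> = cpow f p - twist l f"
      unfolding fab twist_add by (simp only: algebra_simps) 
    finally show ?case .
  qed
  from this[of "carrier G" f] f show ?thesis by (auto simp: on_group_def)
qed


lemma cpow_prime_power_cong:
  assumes p: "Factorial_Ring.prime (p::nat)" and l: "[l * p = 1] (mod order G)"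
    and f: "on_group f"
  shows "of_nat p dvd cpow f (p ^ m) - twist (l ^ m) f"
proof (induction m)
  case 0
  have "cpow f (p ^ 0) = f" "twist (l ^ 0) f = f"
    using f cpow_1 twist_1 by simp_all
  then show ?case by (simp only: diff_self dvd_0_right)
next
  case (Suc m)
  have "of_nat p dvd cpow (cpow f (p ^ m)) p - twist l (cpow f (p ^ m))"
    by (rule cpow_prime_cong[OF p l]) simp
  moreover have "of_nat p dvd twist l (cpow f (p ^ m) - twist (l ^ m) f)"
    by (rule dvd_twist[OF Suc.IH])
  ultimately have "of_nat p dvd (cpow (cpow f (p ^ m)) p - twist l (cpow f (p ^ m)))
      + twist l (cpow f (p ^ m) - twist (l ^ m) f)"
    by (rule dvd_add)
  also have "\<dots> = cpow f (p ^ Suc m) - twist (l ^ Suc m) f"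
    by (simp only: twist_diff twist_twist power_Suc2[of p] power_Suc[of l] cpow_mult diff_telescope)
  finally show ?case .
qed

text \<open>Iterating the Frobenius congruence over a multiple of the totient of the group order
  turns the twist into the identity. Every element thus equals one of its own higher powers modulo
  \<open>p\<close>.\<close>

lemma cpow_periodic:
  assumes p: "Factorial_Ring.prime (p::nat)" "coprime p (order G)" and f: "on_group f"
  obtains N where "N > 2" "of_nat p dvd cpow f N - f"
proof -
  obtain l where "[p * l = 1] (mod order G)"
    using cong_solve_coprime_nat[OF p(2)] by auto
  then have l: "[l * p = 1] (mod order G)" by (simp add: mult.commute)
  \<comment> \<open>The factor 2 guarantees m \<ge> 2 even when the totient is 1, and hence an
    exponent p^m above 2.\<close>
  define m where "m = 2 * totient (order G)"
  have cl: "coprime l (order G)"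
    using l coprime_iff_invertible_nat by auto
  have op: "order G > 0" by (simp add: order_gt_0_iff_finite)
  have "m \<ge> 2" using op by (simp add: m_def Suc_le_eq)
  have "[l ^ totient (order G) = 1] (mod order G)"
    by (rule euler_theorem[OF cl])
  then have lm: "[l ^ m = Suc 0] (mod order G)"
    unfolding m_def by (metis One_nat_def cong_pow mult.commute power_mult power_one)
  have "of_nat p dvd cpow f (p ^ m) - twist (l ^ m) f"
    by (rule cpow_prime_power_cong[OF p(1) l f])
  also have "twist (l ^ m) f = f"
    by (simp only: twist_cong[OF lm] twist_1[OF f])
  finally have "of_nat p dvd cpow f (p ^ m) - f" .
  moreover have "p ^ m > 2"
  proof -
    have "2 \<le> p" using p(1) by (rule prime_ge_2_nat)
    then have "2 ^ 2 \<le> p ^ m" using \<open>m \<ge> 2\<close>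
      by (meson le_trans power_increasing power_mono one_le_numeral le_numeral_extra(1) zero_le)
    then show ?thesis by simp
  qed
  ultimately show thesis using that by blast
qed


text \<open>Modulo \<open>p\<close> the element is congruent to a power of itself that contains its
  square, so it vanishes as soon as its square does. Dividing by \<open>p\<close> and repeating
  gives the higher powers.\<close>

lemma group_ring_reduced:
  assumes p: "Factorial_Ring.prime (p::nat)" "coprime p (order G)"
    and y: "on_group y" "of_nat (p ^ (2 * r)) dvd y \<star> y"
  shows "of_nat (p ^ r) dvd y"
  using y
proof (induction r arbitrary: y)
  case 0
  then show ?case by (simp only: power_0 of_nat_1 one_dvd)
next
  case (Suc r)
  have pp: "p ^ (2 * Suc r) = p * (p * p ^ (2 * r))" by simp
  from Suc.prems(1) obtain N where N: "N > 2" "of_nat p dvd cpow y N - y"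
    using cpow_periodic[OF p] by metis
  have "of_nat p dvd y \<star> y"
    using Suc.prems(2) unfolding pp of_nat_mult by (rule dvd_mult_left)
  then have "of_nat p dvd (y \<star> y) \<star> cpow y (N - 2)"
    by (rule dvd_conv_left)
  also have "(y \<star> y) \<star> cpow y (N - 2) = cpow y (Suc (Suc (N - 2)))"
    by (simp only: cpow_Suc conv_assoc)
  also have "Suc (Suc (N - 2)) = N" using N by simp
  finally have "of_nat p dvd cpow y N - (cpow y N - y)"
    using N(2) by (rule dvd_diff)
  then have "of_nat p dvd y" by simp
  then obtain z where z: "y = of_nat p * z" ..
  have "p > 0" using p by (simp add: prime_gt_0_nat)
  have gz: "on_group z"
    using Suc.prems(1) \<open>p > 0\<close> by (auto simp: on_group_def z)
  have "y \<star> y = of_nat p * (of_nat p * (z \<star> z))"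
    unfolding z conv_of_nat_left conv_of_nat_right ..
  then have "of_nat (p ^ (2 * r)) dvd z \<star> z"
    using Suc.prems(2) \<open>p > 0\<close> unfolding pp of_nat_dvd_fun_iff by simp
  then have "of_nat (p ^ r) dvd z"
    by (rule Suc.IH[OF gz])
  then show ?case
    unfolding z power_Suc of_nat_mult by (rule mult_dvd_mono[OF dvd_refl])
qed

text \<open>The group ring over the \<open>p\<close>-adic integers is a product of unramified extensions, and
  twisting by \<open>p\<close> acts on them by Frobenius automorphisms, which preserve valuations. The proof
  below only uses the congruence \<open>twist l x \<equiv> x\<^sup>p\<close> modulo \<open>p\<close>.\<close>
lemma twist_annihilates:
  assumes p: "Factorial_Ring.prime (p::nat)" "coprime p (order G)" and l: "[l * p = 1] (mod order G)"
    and x: "on_group x" "of_nat (p ^ r) dvd x \<star> y"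
  shows "of_nat (p ^ r) dvd twist l x \<star> y"
  using x
proof (induction r arbitrary: x)
  case 0
  then show ?case by (simp only: power_0 of_nat_1 one_dvd)
next
  case (Suc r)
  define R where "R = Suc r"
  let ?T = "twist l x"
  have xy: "of_nat (p ^ R) dvd x \<star> y" using Suc.prems unfolding R_def by blast
  have "p > 0" using p by (simp add: prime_gt_0_nat)
  from Suc.prems(1) obtain N where N: "N > 2" "of_nat p dvd cpow x N - x"
    using cpow_periodic[OF p] by metis
  define M where "M = N - 3"
  have NM: "N = Suc (Suc (Suc M))" using N by (simp add: M_def)
  \<comment> \<open>The difference is divisible by \<open>p\<close>, and its product with
    \<open>y\<close> inherits divisibility by \<open>p ^ R\<close> from \<open>x \<star> y\<close>.
    The induction hypothesis therefore applies to \<open>z\<close>, the quotient by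
    \<open>p\<close>.\<close>
  define z' where "z' = x - cpow x N"
  have "of_nat p dvd z'"
    using N(2) unfolding z'_def by (subst dvd_minus_iff[symmetric]) (simp only: minus_diff_eq)
  then obtain z where z: "z' = of_nat p * z" ..
  have gz: "on_group z"
    using Suc.prems(1) \<open>p > 0\<close> on_group_diff[OF Suc.prems(1) on_group_cpow[of x N]]
    unfolding z'_def[symmetric] z on_group_def by simp
  have "of_nat (p ^ R) dvd z' \<star> y"
  proof -
    have "z' \<star> y = x \<star> y - (x \<star> y) \<star> cpow x (N - 1)"
      unfolding z'_def NM cpow_Suc diff_Suc_1 conv_diff_left by (simp only: conv_ac)
    then show ?thesis
      using dvd_diff[OF xy dvd_conv_left[OF xy]] by simp
  qed
  then have "of_nat (p ^ r) dvd z \<star> y"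
    using \<open>p > 0\<close> unfolding R_def z conv_of_nat_left of_nat_dvd_fun_iff by simp
  then have "of_nat (p ^ r) dvd twist l z \<star> y"
    by (rule Suc.IH[OF gz])
  then have "of_nat p * of_nat (p ^ r) dvd of_nat p * (twist l z \<star> y)"
    by (rule mult_dvd_mono[OF dvd_refl])
  then have "of_nat (p ^ R) dvd twist l z' \<star> y"
    unfolding R_def z twist_of_nat conv_of_nat_left power_Suc of_nat_mult .
  also have "twist l z' \<star> y = ?T \<star> y - cpow ?T N \<star> y"
    unfolding z'_def twist_diff twist_cpow[OF l] conv_diff_left ..
  finally have step: "of_nat (p ^ R) dvd ?T \<star> y - cpow ?T N \<star> y" .
  \<comment> \<open>The exponent of \<open>?T\<close> can be raised by N - 1 =
    \<open>Suc (Suc M)\<close> any number of times without changing the product with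
    \<open>y\<close> modulo \<open>p ^ R\<close>.\<close>
  have iter: "of_nat (p ^ R) dvd ?T \<star> y - cpow ?T (Suc (i * Suc (Suc M))) \<star> y" for i
  proof (induction i)
    case 0
    have "cpow ?T (Suc (0 * Suc (Suc M))) = ?T" by (simp only: mult_0 cpow_1[OF on_group_twist])
    then show ?case by (simp only: diff_self dvd_0_right)
  next
    case (Suc i)
    have "of_nat (p ^ R) dvd cpow ?T (i * Suc (Suc M)) \<star> (?T \<star> y - cpow ?T N \<star> y)"
      by (rule dvd_conv_right[OF step])
    also have "\<dots> = cpow ?T (Suc (i * Suc (Suc M))) \<star> y - cpow ?T (Suc (Suc i * Suc (Suc M))) \<star> y"
    proof -
      have "Suc (Suc i * Suc (Suc M)) = i * Suc (Suc M) + N" by (simp add: NM)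
      then have "cpow ?T (Suc (Suc i * Suc (Suc M))) = cpow ?T (i * Suc (Suc M)) \<star> cpow ?T N"
        by (simp only: cpow_add)
      then show ?thesis by (simp only: conv_diff_right cpow_Suc conv_ac)
    qed
    finally show ?case using Suc.IH by (metis diff_telescope dvd_add)
  qed
  have "of_nat p dvd ?T - cpow x p"
    using cpow_prime_cong[OF p(1) l Suc.prems(1)]
    by (subst dvd_minus_iff[symmetric]) (simp only: minus_diff_eq)
  then obtain w where w: "?T - cpow x p = of_nat p * w" ..
  then have T: "?T = cpow x p + of_nat p * w" by (metis add_diff_cancel_left' diff_add_cancel add.commute)
  \<comment> \<open>In a power of T = x^p + p w every term containing x^p is killed by
    \<open>y\<close> modulo \<open>p ^ R\<close>, so only the power of p w survives.\<close>
  have pow: "of_nat (p ^ R) dvd cpow ?T K \<star> y - of_nat (p ^ K) * (cpow w K \<star> y)" for K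
  proof (induction K)
    case 0
    show ?case by (simp only: cpow_0 power_0 of_nat_1 mult_1 diff_self dvd_0_right)
  next
    case (Suc K)
    let ?e = "of_nat (p ^ K) * (cpow w K \<star> y)"
    have "of_nat (p ^ R) dvd ?T \<star> (cpow ?T K \<star> y - ?e)"
      by (rule dvd_conv_right[OF Suc.IH])
    moreover have "of_nat (p ^ R) dvd ?T \<star> ?e - of_nat (p ^ Suc K) * (cpow w (Suc K) \<star> y)"
    proof -
      obtain p' where p': "p = Suc p'" using \<open>p > 0\<close> gr0_conv_Suc by blast
      have "?T \<star> ?e - of_nat (p ^ Suc K) * (cpow w (Suc K) \<star> y) = cpow x p \<star> ?e"
      proof -
        have "(of_nat p * w) \<star> ?e = of_nat (p ^ Suc K) * (cpow w (Suc K) \<star> y)"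
          by (simp only: conv_of_nat_left conv_of_nat_right power_Suc of_nat_mult mult.assoc
              mult.left_commute cpow_Suc conv_assoc)
        then show ?thesis unfolding T conv_add_left by (simp only: add_diff_cancel_right')
      qed
      also have "\<dots> = (x \<star> y) \<star> (cpow x p' \<star> (of_nat (p ^ K) * cpow w K))"
        unfolding p' cpow_Suc conv_of_nat_right conv_of_nat_left by (simp only: conv_ac)
      finally show ?thesis using dvd_conv_left[OF xy] by simp
    qed
    ultimately have "of_nat (p ^ R) dvd (?T \<star> (cpow ?T K \<star> y) - ?T \<star> ?e)
       + (?T \<star> ?e - of_nat (p ^ Suc K) * (cpow w (Suc K) \<star> y))"
      unfolding conv_diff_right by (rule dvd_add)
    then show ?case by (simp only: diff_telescope cpow_Suc conv_assoc)
  qed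
  \<comment> \<open>An exponent that \<open>iter\<close> reaches and that is at least
    \<open>R\<close>, so that p^K is divisible by p^R.\<close>
  define K where "K = Suc (R * Suc (Suc M))"
  have "R \<le> K" unfolding K_def by simp
  then have "p ^ R dvd p ^ K" by (rule le_imp_power_dvd)
  then have "(of_nat (p ^ R) :: 'a \<Rightarrow> int) dvd of_nat (p ^ K) * (cpow w K \<star> y)"
    unfolding of_nat_dvd_fun_iff by (simp add: dvd_mult2 del: of_nat_power) 
  from dvd_add[OF iter[of R, folded K_def] dvd_add[OF pow[of K] this]]
  show ?case unfolding R_def by (simp only: diff_add_cancel)
qed

section \<open>Multipliers of difference sets\<close>

definition ind :: "'a set \<Rightarrow> 'a \<Rightarrow> int" where
  "ind S = (\<lambda>x. if x \<in> S then 1 else 0)"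

definition reflect :: "('a \<Rightarrow> int) \<Rightarrow> 'a \<Rightarrow> int" where
  "reflect f = (\<lambda>u. if u \<in> carrier G then f (inv u) else 0)"

lemma order_pos: "order G > 0"
  by (simp add: order_gt_0_iff_finite)

lemma on_group_ind [simp]: "S \<subseteq> carrier G \<Longrightarrow> on_group (ind S)"
  by (auto simp: on_group_def ind_def)

lemma sum_ind: "S \<subseteq> carrier G \<Longrightarrow> (\<Sum>x\<in>carrier G. ind S x) = int (card S)"
  by (simp add: ind_def sum.If_cases Int_absorb1)

lemma sum_ind_mult:
  "S \<subseteq> carrier G \<Longrightarrow> (\<Sum>x\<in>carrier G. ind S x * f x) = (\<Sum>x\<in>S. f x)"
proof -
  assume S: "S \<subseteq> carrier G"
  have "(\<Sum>x\<in>carrier G. ind S x * f x) = (\<Sum>x\<in>carrier G. if x \<in> S then f x else 0)"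
    by (intro sum.cong) (auto simp: ind_def)
  then show ?thesis using S by (simp add: sum.If_cases Int_absorb1)
qed

lemma sum_reflect: "(\<Sum>x\<in>carrier G. reflect f x) = (\<Sum>x\<in>carrier G. f x)"
  by (intro sum.reindex_bij_witness[where i = "m_inv G" and j = "m_inv G"])
     (auto simp: reflect_def)

lemma sum_translate:
  "g \<in> carrier G \<Longrightarrow> (\<Sum>x\<in>carrier G. f (g \<otimes> x)) = (\<Sum>x\<in>carrier G. f x)"
  by (intro sum.reindex_bij_witness[where i = "\<lambda>x. inv g \<otimes> x" and j = "\<lambda>x. g \<otimes> x"]) auto

lemma conv_ind_carrier:
  assumes "u \<in> carrier G"
  shows "(ind (carrier G) \<star> f) u = (\<Sum>x\<in>carrier G. f x)"
proof -
  have "(f \<star> ind (carrier G)) u = (\<Sum>x\<in>carrier G. f x)"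
    using assms by (simp add: conv_def ind_def)
  then show ?thesis by (simp only: conv_comm)
qed

lemma sum_conv:
  "(\<Sum>u\<in>carrier G. (f \<star> g) u) = (\<Sum>x\<in>carrier G. f x) * (\<Sum>x\<in>carrier G. g x)"
proof -
  have "(\<Sum>u\<in>carrier G. (f \<star> g) u)
      = (\<Sum>x\<in>carrier G. \<Sum>u\<in>carrier G. f x * g (inv x \<otimes> u))"
    by (subst sum.swap) (simp add: conv_def)
  also have "\<dots> = (\<Sum>x\<in>carrier G. f x * (\<Sum>u\<in>carrier G. g u))"
    by (simp add: sum_distrib_left[symmetric] sum_translate)
  finally show ?thesis by (simp add: sum_distrib_right)
qed

lemma conv_ind_reflect:
  assumes "S \<subseteq> carrier G" "u \<in> carrier G"
  shows "(ind S \<star> reflect f) u = (\<Sum>x\<in>S. f (inv u \<otimes> x))"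
proof -
  have "(ind S \<star> reflect f) u = (\<Sum>x\<in>carrier G. ind S x * f (inv u \<otimes> x))"
    using assms by (auto simp: conv_def reflect_def inv_mult m_comm intro!: sum.cong)
  then show ?thesis using assms sum_ind_mult by simp
qed

text \<open>A representation of \<open>g\<close> is determined by its second entry. The later counts
  all use this form with a single variable.\<close>

lemma card_differences:
  assumes "S \<subseteq> carrier G" "T \<subseteq> carrier G" "g \<in> carrier G"
  shows "card {(d1, d2). d1 \<in> S \<and> d2 \<in> T \<and> d1 \<otimes> inv d2 = g} = card {d \<in> T. g \<otimes> d \<in> S}"
proof (rule bij_betw_same_card[of snd], rule bij_betw_byWitness[where f' = "\<lambda>d. (g \<otimes> d, d)"])
  have "g \<otimes> d2 = d1 \<longleftrightarrow> d1 \<otimes> inv d2 = g" if "d1 \<in> S" "d2 \<in> T" for d1 d2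
    using that assms by (metis inv_solve_right subsetD)
  moreover have "d1 \<otimes> inv d2 \<otimes> d2 = d1" if "d1 \<in> S" "d2 \<in> T" for d1 d2
    using that assms by (simp add: m_assoc subsetD)
  ultimately show "\<forall>a\<in>{(d1, d2). d1 \<in> S \<and> d2 \<in> T \<and> d1 \<otimes> inv d2 = g}. (g \<otimes> snd a, snd a) = a"
    "snd ` {(d1, d2). d1 \<in> S \<and> d2 \<in> T \<and> d1 \<otimes> inv d2 = g} \<subseteq> {d \<in> T. g \<otimes> d \<in> S}"
    "(\<lambda>d. (g \<otimes> d, d)) ` {d \<in> T. g \<otimes> d \<in> S} \<subseteq> {(d1, d2). d1 \<in> S \<and> d2 \<in> T \<and> d1 \<otimes> inv d2 = g}"
    by auto
qed auto

lemma difference_set_iff: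
  assumes "D \<subseteq> carrier G"
  shows "difference_set G D v k lam \<longleftrightarrow> order G = v \<and> card D = k \<and>
    (\<forall>g \<in> carrier G - {\<one>}. card {d \<in> D. g \<otimes> d \<in> D} = lam)"
  using assms by (auto simp: difference_set_def order_def card_differences)

lemma card_eq_sum_ind:
  "finite S \<Longrightarrow> int (card {d \<in> S. P d}) = (\<Sum>d\<in>S. if P d then 1 else 0)"
  by (simp add: sum.If_cases Int_def)

text \<open>The group ring equation D D^(-1) = lam G + (k - lam) 1, read coefficient by
  coefficient.\<close>

lemma difference_set_conv:
  assumes "difference_set G D v k lam" and u: "u \<in> carrier G"
  shows "(ind D \<star> reflect (ind D)) u = (if u = \<one> then int k else int lam)"
proof -
  have D: "D \<subseteq> carrier G" using assms by (simp add: difference_set_def)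
  have "(ind D \<star> reflect (ind D)) u = int (card {d \<in> D. inv u \<otimes> d \<in> D})"
    using finite_subset[OF D] by (simp only: conv_ind_reflect[OF D u] card_eq_sum_ind finite_carrier)
      (simp add: ind_def)
  then show ?thesis
    using assms u D
    by (cases "u = \<one>") (auto simp: difference_set_iff intro!: arg_cong[where f = card])
qed

lemma twist_ind:
  assumes l: "[l * p = 1] (mod order G)" and S: "S \<subseteq> carrier G"
  shows "twist l (ind S) = ind ((\<lambda>x. x [^] p) ` S)"
proof
  fix u
  have pl: "[p * l = 1] (mod order G)" using l by (simp add: mult.commute)
  show "twist l (ind S) u = ind ((\<lambda>x. x [^] p) ` S) u"
  proof (cases "u \<in> carrier G")
    case True
    have "u [^] l \<in> S \<longleftrightarrow> u \<in> (\<lambda>x. x [^] p) ` S"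
      using True S pow_pow_inverse[OF l True] pow_pow_inverse[OF pl]
      by (metis (no_types, lifting) image_iff subsetD)
    with True show ?thesis by (simp add: twist_def ind_def)
  next
    case False
    then show ?thesis using S by (auto simp: twist_def ind_def)
  qed
qed

lemma inj_on_pow:
  assumes "coprime p (order G)" shows "inj_on (\<lambda>x. x [^] (p::nat)) (carrier G)"
proof -
  obtain l where "[p * l = 1] (mod order G)"
    using cong_solve_coprime_nat[OF assms] by auto
  then show ?thesis by (intro inj_on_inverseI[where g = "\<lambda>x. x [^] l"] pow_pow_inverse)
qed

text \<open>Augmentation of the group ring equation: all coefficients on both sides are
  summed.\<close>

lemma difference_set_count:
  assumes "difference_set G D v k lam"
  shows "int k * int k = int lam * int v + (int k - int lam)"
proof -
  have D: "D \<subseteq> carrier G" and kv: "card D = k" "card (carrier G) = v"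
    using assms by (auto simp: difference_set_def)
  have "int k * int k = (\<Sum>u\<in>carrier G. (ind D \<star> reflect (ind D)) u)"
    using D kv by (simp add: sum_conv sum_reflect sum_ind)
  also have "\<dots> = (\<Sum>u\<in>carrier G. int lam + (if u = \<one> then int k - int lam else 0))"
    by (intro sum.cong refl) (simp add: difference_set_conv[OF assms])
  also have "\<dots> = int lam * int v + (int k - int lam)"
    using kv by (simp only: sum.distrib) simp
  finally show ?thesis .
qed

text \<open>Multiplier theorem when n = k - lam is a power of \<open>p\<close> above
  \<open>lam\<close>. Divisibility by n passes from \<open>D\<close> to its image \<open>D'\<close>
  under the \<open>p\<close>-th power map, so that D' D^(-1) = lam G + n S with S integral.
  Positivity and the total of the coefficients force S to be a single group element.\<close>

theorem prime_multiplier: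
  assumes D: "difference_set G D v k lam"
    and p: "Factorial_Ring.prime (p::nat)" "coprime p v"
    and k: "k = lam + p ^ r" "lam < p ^ r"
  shows "\<exists>g\<in>carrier G. (\<lambda>d. d [^] p) ` D = (\<lambda>d. g \<otimes> d) ` D"
proof -
  have DG: "D \<subseteq> carrier G" and kv: "card D = k" "order G = v"
    using D by (auto simp: difference_set_def order_def)
  have pv: "coprime p (order G)" using p kv by simp
  obtain l where "[p * l = 1] (mod order G)"
    using cong_solve_coprime_nat[OF pv] by auto
  then have l: "[l * p = 1] (mod order G)" by (simp add: mult.commute)
  define J where "J = ind (carrier G)"
  define y where "y = reflect (ind D)"
  define D' where "D' = (\<lambda>d. d [^] p) ` D"
  define n where "n = int (p ^ r)"
  have npos: "n > 0" using k unfolding n_def by linarith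
  have D'G: "D' \<subseteq> carrier G" using DG by (auto simp: D'_def)
  have cD': "card D' = k" unfolding D'_def
    using kv inj_on_subset[OF inj_on_pow[OF pv] DG] by (simp add: card_image)
  have sy: "(\<Sum>x\<in>carrier G. y x) = int k"
    using DG kv by (simp add: y_def sum_reflect sum_ind)
  have Dy: "(ind D \<star> y) u = int lam + n * delta \<one> u" if "u \<in> carrier G" for u
    using difference_set_conv[OF D that] k by (auto simp: y_def delta_def n_def)
  have Jy: "(J \<star> y) u = int k" if "u \<in> carrier G" for u
    unfolding J_def using that sy by (simp add: conv_ind_carrier)
  \<comment> \<open>Subtracting \<open>J\<close> replaces the coefficient \<open>lam\<close> by lam
    - k = -n, which makes the product n times (1 - J).\<close>
  have "of_nat (p ^ r) dvd (ind D - J) \<star> y"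
    unfolding of_nat_dvd_fun_iff
  proof
    fix u show "int (p ^ r) dvd ((ind D - J) \<star> y) u"
    proof (cases "u \<in> carrier G")
      case True
      then have "((ind D - J) \<star> y) u = n * (delta \<one> u - 1)"
        using k by (simp only: conv_diff_left minus_apply Dy Jy) (simp add: n_def algebra_simps)
      then show ?thesis by (simp add: n_def)
    qed (simp add: conv_def)
  qed
  then have "of_nat (p ^ r) dvd twist l (ind D - J) \<star> y"
    using DG by (intro twist_annihilates[OF p(1) pv l]) (simp_all add: J_def)
  also have "twist l (ind D - J) = ind D' - J"
  proof -
    have "twist l J = J" by (auto simp: J_def twist_def ind_def)
    then show ?thesis by (simp only: twist_diff twist_ind[OF l DG] D'_def)
  qed
  finally have dv: "n dvd (ind D' \<star> y) u - int lam" if "u \<in> carrier G" for u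
  proof -
    assume "of_nat (p ^ r) dvd (ind D' - J) \<star> y"
    then have "n dvd (ind D' \<star> y) u - int k"
      using that unfolding of_nat_dvd_fun_iff n_def
      by (simp only: conv_diff_left minus_apply) (metis Jy[OF that])
    then have "n dvd (ind D' \<star> y) u - int k + n" by simp
    then show ?thesis using k by (simp add: n_def)
  qed
  define S where "S u = ((ind D' \<star> y) u - int lam) div n" for u
  have S: "(ind D' \<star> y) u = int lam + n * S u" if "u \<in> carrier G" for u
    using dv[OF that] by (simp add: S_def)
  \<comment> \<open>A negative value would make the non-negative coefficient lam + n S at most lam -
    n, which is negative.\<close>
  have S0: "S u \<ge> 0" if "u \<in> carrier G" for u
  proof -
    have "(ind D' \<star> y) u \<ge> 0"
      unfolding conv_def by (auto simp: ind_def y_def reflect_def intro!: sum_nonneg)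
    moreover have "int lam < n" using k(2) by (simp only: n_def of_nat_less_iff)
    ultimately have "n * S u > n * (-1)" using S[OF that] by linarith
    then show ?thesis using npos by (simp only: mult_less_cancel_left_pos)
  qed
  have "int k * int k = (\<Sum>u\<in>carrier G. (ind D' \<star> y) u)"
    using D'G cD' sy by (simp add: sum_conv sum_ind)
  also have "\<dots> = (\<Sum>u\<in>carrier G. int lam + n * S u)"
    by (intro sum.cong refl S)
  also have "\<dots> = int lam * int v + n * (\<Sum>u\<in>carrier G. S u)"
    using kv by (simp add: sum.distrib sum_distrib_left order_def)
  finally have "n * (\<Sum>u\<in>carrier G. S u) = n * 1"
    using difference_set_count[OF D] k by (simp add: n_def)
  then have S1: "(\<Sum>u\<in>carrier G. S u) = 1" using npos by simp
  then obtain g where g: "g \<in> carrier G" "S g \<noteq> 0"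
    by (metis sum.neutral zero_neq_one)
  have "S g + (\<Sum>u\<in>carrier G - {g}. S u) = 1"
    using S1 g by (simp add: sum.remove)
  moreover have "(\<Sum>u\<in>carrier G - {g}. S u) \<ge> 0" using S0 by (intro sum_nonneg) auto
  ultimately have Sg: "S g = 1" "(\<Sum>u\<in>carrier G - {g}. S u) = 0" using S0[OF g(1)] g(2) by auto
  have "\<forall>u\<in>carrier G - {g}. S u = 0"
    using Sg(2) S0 by (subst (asm) sum_nonneg_eq_0_iff) auto
  then have "S u = delta g u" if "u \<in> carrier G" for u
    using that Sg(1) by (auto simp: delta_def)
  then have D'y: "ind D' \<star> y = (\<lambda>_. int lam) * J + (\<lambda>_. n) * delta g"
    using S g by (auto simp: fun_eq_iff J_def ind_def delta_def) (simp_all add: conv_def)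
  have Dy': "ind D \<star> y = (\<lambda>_. int lam) * J + (\<lambda>_. n) * delta \<one>"
    using Dy by (auto simp: fun_eq_iff J_def ind_def delta_def) (simp_all add: conv_def)
  \<comment> \<open>Computing D D' D^(-1) in two ways eliminates D^(-1). The multiples of
    \<open>J\<close> agree because \<open>D\<close> and \<open>D'\<close> have equal size, and n
    cancels.\<close>
  have "ind D' \<star> (ind D \<star> y) = ind D \<star> (ind D' \<star> y)" by (simp only: conv_ac)
  then have eq: "(\<lambda>_. int lam) * (ind D' \<star> J) + (\<lambda>_. n) * (ind D' \<star> delta \<one>)
      = (\<lambda>_. int lam) * (ind D \<star> J) + (\<lambda>_. n) * (ind D \<star> delta g)"
    unfolding D'y Dy' conv_add_right conv_const_right .
  have main: "ind D' u = ind D (inv g \<otimes> u)" if "u \<in> carrier G" for u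
  proof -
    have "(ind D' \<star> J) u = (ind D \<star> J) u"
    proof -
      have "(J \<star> ind D') u = (J \<star> ind D) u"
        using that DG D'G kv cD' by (simp add: J_def conv_ind_carrier sum_ind)
      then show ?thesis by (simp only: conv_comm[of _ J])
    qed
    then have "n * (ind D' \<star> delta \<one>) u = n * (ind D \<star> delta g) u"
      using fun_cong[OF eq, of u] by simp
    then have "(delta \<one> \<star> ind D') u = (delta g \<star> ind D) u"
      using npos by (simp add: conv_comm)
    then show ?thesis using that g by (simp add: conv_delta_left)
  qed
  have "D' = (\<lambda>d. g \<otimes> d) ` D"
  proof (intro Set.set_eqI iffI)
    fix u assume u: "u \<in> D'"
    then have "u \<in> carrier G" using D'G by auto
    then have "inv g \<otimes> u \<in> D" "u = g \<otimes> (inv g \<otimes> u)"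
      using main[of u] u g by (auto simp: ind_def split: if_splits)
    then show "u \<in> (\<lambda>d. g \<otimes> d) ` D" by (rule rev_image_eqI)
  next
    fix u assume "u \<in> (\<lambda>d. g \<otimes> d) ` D"
    then obtain d where "d \<in> D" "u = g \<otimes> d" by auto
    then show "u \<in> D'"
      using main[of u] DG g by (auto simp: ind_def split: if_splits)
  qed
  then show ?thesis using g by (auto simp: D'_def)
qed

lemma pow_eq_one_gcd:
  assumes "x \<in> carrier G" "x [^] (a::nat) = \<one>" "x [^] (b::nat) = \<one>"
  shows "x [^] gcd a b = \<one>"
  using assms by (simp add: pow_eq_id)

lemma pow_eq_one_dvd:
  assumes "x \<in> carrier G" "x [^] (a::nat) = \<one>" "a dvd b"
  shows "x [^] b = \<one>"
  using assms by (auto simp: pow_eq_id)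

lemma finprod_pow:
  "f \<in> A \<rightarrow> carrier G \<Longrightarrow> finprod G (\<lambda>x. f x [^] (n::nat)) A = finprod G f A [^] n"
  by (induction n) (auto simp: finprod_multf Pi_def)

text \<open>The image of \<open>D\<close> has product 1, while the translate by \<open>g\<close> has
  product g^k. As \<open>k\<close> is coprime to the group order, g = 1.\<close>

lemma normalized_prime_multiplier:
  assumes D: "normalized_difference_set G D v k lam"
    and p: "Factorial_Ring.prime (p::nat)" "coprime p v"
    and k: "k = lam + p ^ r" "lam < p ^ r" "coprime k v"
  shows "(\<lambda>d. d [^] p) ` D = D"
proof -
  have DS: "difference_set G D v k lam" and D1: "finprod G (\<lambda>d. d) D = \<one>"
    using D by (auto simp: normalized_difference_set_def)
  have DG: "D \<subseteq> carrier G" and kv: "card D = k" "order G = v"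
    using DS by (auto simp: difference_set_def order_def)
  obtain g where g: "g \<in> carrier G" and eq: "(\<lambda>d. d [^] p) ` D = (\<lambda>d. g \<otimes> d) ` D"
    using prime_multiplier[OF DS p k(1,2)] by auto
  have "\<one> = finprod G (\<lambda>d. d [^] p) D"
    using DG D1 by (subst finprod_pow) auto
  also have "\<dots> = finprod G (\<lambda>d. d) ((\<lambda>d. d [^] p) ` D)"
    using DG inj_on_subset[OF inj_on_pow DG, of p] p kv by (subst finprod_reindex) auto
  also have "\<dots> = finprod G (\<lambda>d. g \<otimes> d) D"
  proof -
    have "inj_on (\<lambda>d. g \<otimes> d) D"
      using DG g by (intro inj_onI) (metis l_cancel subsetD)
    then show ?thesis unfolding eq using DG g by (subst finprod_reindex) auto
  qed
  also have "\<dots> = g [^] k"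
    using DG g D1 kv by (subst finprod_multf) (auto simp: finprod_const)
  finally have "g [^] k = \<one>" by simp
  moreover have "g [^] v = \<one>" using g kv by (auto simp: pow_order_eq_1)
  ultimately have "g = \<one>"
    using pow_eq_one_gcd[of g k v] g k(3) by (simp add: coprime_iff_gcd_eq_1 del: One_nat_def)
  then show ?thesis using eq DG by (auto simp: image_def subsetD)
qed

section \<open>Subgroups of finite abelian groups\<close>

lemma subgroup_pow_closed:
  "subgroup H G \<Longrightarrow> x \<in> H \<Longrightarrow> x [^] (n::nat) \<in> H"
  by (induction n) (auto simp: subgroup.one_closed subgroup.m_closed)

text \<open>The quotient by \<open>H\<close> has order \<open>h\<close>, so every
  \<open>h\<close>-th power is trivial in it.\<close>

lemma pow_index_mem:
  assumes H: "subgroup H G" and h: "card H * h = order G" and x: "x \<in> carrier G"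
  shows "x [^] h \<in> H"
proof -
  interpret N: normal H G using H by (rule subgroup_imp_normal)
  interpret F: group "G Mod H" by (rule N.factorgroup_is_group)
  have fin: "finite H" using finite_subset[OF subgroup.subset[OF H] finite_carrier] .
  have "card H > 0" using fin subgroup.one_closed[OF H] by (metis card_gt_0_iff empty_iff)
  then have oF: "order (G Mod H) = h"
  proof -
    have "card (rcosets H) * card H = h * card H"
      using lagrange[OF H] h by (simp add: mult.commute)
    then show ?thesis using \<open>card H > 0\<close> by (simp add: order_def FactGroup_def)
  qed
  have pw: "(H #> x) [^]\<^bsub>G Mod H\<^esub> n = H #> x [^] n" for n :: nat
    using x coset_mult_one[OF subgroup.subset[OF H]]
    by (induction n) (simp_all add: FactGroup_def N.rcos_sum)
  have "H #> x \<in> carrier (G Mod H)" using x by (auto simp: FactGroup_def RCOSETS_def)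
  then have "H #> x [^] h = H"
    using F.pow_order_eq_1 pw[of h] oF by (simp add: FactGroup_def)
  then show ?thesis using x H by (metis nat_pow_closed rcos_self)
qed

text \<open>Each element of the product set has as many factorizations as
  \<open>H \<inter> K\<close> has elements.\<close>

lemma card_set_mult:
  assumes H: "subgroup H G" and K: "subgroup K G"
  shows "card (H <#> K) * card (H \<inter> K) = card H * card K"
proof -
  note HG = subgroup.subset[OF H] and KG = subgroup.subset[OF K]
  have fin: "finite H" "finite K" using finite_subset[OF HG finite_carrier] finite_subset[OF KG finite_carrier] .
  have fibre: "card {z \<in> H \<times> K. fst z \<otimes> snd z = g} = card (H \<inter> K)" if g: "g \<in> H <#> K" for g
  proof -
    obtain h k where hk: "h \<in> H" "k \<in> K" "g = h \<otimes> k"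
      using g by (auto simp: set_mult_def)
    have [simp]: "h \<in> carrier G" "k \<in> carrier G" using hk HG KG by auto
    show ?thesis
    proof (rule bij_betw_same_card[of "\<lambda>z. inv h \<otimes> fst z"],
        rule bij_betw_byWitness[where f' = "\<lambda>t. (h \<otimes> t, inv t \<otimes> k)"])
      show "\<forall>z\<in>{z \<in> H \<times> K. fst z \<otimes> snd z = g}.
          (h \<otimes> (inv h \<otimes> fst z), inv (inv h \<otimes> fst z) \<otimes> k) = z"
      proof
        fix z assume "z \<in> {z \<in> H \<times> K. fst z \<otimes> snd z = g}"
        then obtain a b where ab: "z = (a, b)" "a \<in> H" "b \<in> K" "a \<otimes> b = g" by auto
        then have [simp]: "a \<in> carrier G" "b \<in> carrier G" using HG KG by auto
        have "inv (inv h \<otimes> a) \<otimes> k = inv a \<otimes> (h \<otimes> k)"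
          by (simp add: inv_mult_group m_assoc)
        also have "h \<otimes> k = a \<otimes> b" using ab hk by simp
        also have "inv a \<otimes> (a \<otimes> b) = b" by simp
        finally show "(h \<otimes> (inv h \<otimes> fst z), inv (inv h \<otimes> fst z) \<otimes> k) = z"
          unfolding ab(1) by simp
      qed
      show "\<forall>t\<in>H \<inter> K. inv h \<otimes> fst (h \<otimes> t, inv t \<otimes> k) = t" using HG by auto
      show "(\<lambda>z. inv h \<otimes> fst z) ` {z \<in> H \<times> K. fst z \<otimes> snd z = g} \<subseteq> H \<inter> K"
      proof (rule image_subsetI)
        fix z assume "z \<in> {z \<in> H \<times> K. fst z \<otimes> snd z = g}"
        then obtain a b where ab: "z = (a, b)" "a \<in> H" "b \<in> K" "a \<otimes> b = g" by auto
        then have [simp]: "a \<in> carrier G" "b \<in> carrier G" using HG KG by auto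
        have "inv h \<otimes> a = inv h \<otimes> (a \<otimes> b \<otimes> inv b)" by (simp add: m_assoc)
        also have "a \<otimes> b = h \<otimes> k" using ab hk by simp
        also have "inv h \<otimes> (h \<otimes> k \<otimes> inv b) = k \<otimes> inv b" by (simp add: m_assoc)
        finally have "inv h \<otimes> a = k \<otimes> inv b" .
        moreover have "inv h \<otimes> a \<in> H" "k \<otimes> inv b \<in> K"
          using ab hk H K by (auto simp: subgroup.m_closed subgroup.m_inv_closed)
        ultimately show "inv h \<otimes> fst z \<in> H \<inter> K" by (simp add: ab(1))
      qed
      show "(\<lambda>t. (h \<otimes> t, inv t \<otimes> k)) ` (H \<inter> K) \<subseteq> {z \<in> H \<times> K. fst z \<otimes> snd z = g}"
      proof (rule image_subsetI)
        fix t assume t: "t \<in> H \<inter> K"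
        then have [simp]: "t \<in> carrier G" using HG by auto
        show "(h \<otimes> t, inv t \<otimes> k) \<in> {z \<in> H \<times> K. fst z \<otimes> snd z = g}"
          using t hk H K by (auto simp: subgroup.m_closed subgroup.m_inv_closed m_assoc)
      qed
    qed
  qed
  have "finite (H <#> K)" using fin by (auto simp: set_mult_def)
  then have "(\<Sum>g\<in>H <#> K. \<Sum>z\<in>{z \<in> H \<times> K. fst z \<otimes> snd z = g}. 1) = (\<Sum>z\<in>H \<times> K. 1::nat)"
    using fin by (intro sum.group) (fastforce simp: set_mult_def)+
  then show ?thesis using fibre by (simp add: card_cartesian_product)
qed

lemma subgroup_card_dvd: "subgroup H G \<Longrightarrow> card H dvd order G"
  using lagrange by (metis dvd_triv_right)

lemma card_Int_dvd:
  assumes "subgroup H G" "subgroup K G" shows "card (H \<inter> K) dvd card H"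
proof -
  interpret S: group "G\<lparr>carrier := H\<rparr>" using assms(1) by (rule subgroup_imp_group)
  have "subgroup (H \<inter> K) (G\<lparr>carrier := H\<rparr>)"
    using assms by (intro subgroup_incl subgroups_Inter_pair) auto
  from S.lagrange[OF this] show ?thesis by (simp add: order_def) (metis dvd_triv_right)
qed

text \<open>Induction on \<open>d\<close> splits off its full \<open>p\<close>-part: a subgroup of
  that prime power order, supplied by the Sylow theorem, is multiplied with one of the coprime order
  \<open>m\<close>.\<close>

lemma exists_subgroup_of_order:
  assumes "d dvd order G"
  shows "\<exists>H. subgroup H G \<and> card H = d"
  using assms
proof (induction d rule: less_induct)
  case (less d)
  have d0: "d > 0" using less.prems order_pos by (auto intro: Nat.gr0I)
  show ?case
  proof (cases "d = 1")
    case True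
    then show ?thesis using triv_subgroup by (intro exI[of _ "{\<one>}"]) auto
  next
    case False
    then obtain p where p: "Factorial_Ring.prime p" "p dvd d" by (metis prime_factor_nat)
    obtain m where m: "d = p ^ multiplicity p d * m" "\<not> p dvd m"
      using d0 p(1) multiplicity_decompose'[of d p] not_prime_unit[of p] by (metis neq0_conv)
    let ?a = "multiplicity p d"
    have "?a > 0" using p d0 by (simp add: prime_multiplicity_gt_zero_iff)
    then have "m < d"
      using m d0 p(2) dvd_imp_le[of m d] by (metis dvd_triv_right le_neq_implies_less)
    moreover have "m dvd order G" using less.prems m by (metis dvd_mult_right)
    ultimately obtain H where H: "subgroup H G" "card H = m" using less.IH by blast
    obtain c where c: "order G = p ^ ?a * c"
      using less.prems m by (metis dvd_def dvd_mult_left)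
    obtain P where P: "subgroup P G" "card P = p ^ ?a"
      using sylow_thm[OF p(1) is_group c finite_carrier] by auto
    have cop: "coprime (card H) (card P)"
      using prime_imp_coprime[OF p(1) m(2)] by (simp add: H P coprime_commute)
    have "card (H \<inter> P) dvd card H" "card (H \<inter> P) dvd card P"
      using card_Int_dvd[OF H(1) P(1)] card_Int_dvd[OF P(1) H(1)] by (simp_all only: Int_commute)
    then have "card (H \<inter> P) = 1" using cop by (metis coprime_common_divisor_nat)
    then have "card (H <#> P) = d"
      using card_set_mult[OF H(1) P(1)] m H P by (simp add: mult.commute)
    then show ?thesis using mult_subgroups[OF H(1) P(1)] by blast
  qed
qed

lemma finprod_free_orbits:
  assumes "finite S" "\<And>y. y \<in> S \<Longrightarrow> f y \<in> S" "\<And>y. y \<in> S \<Longrightarrow> (f ^^ k) y = y" "k > 0"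
    and inj: "\<And>y. y \<in> S \<Longrightarrow> inj_on (\<lambda>i. (f ^^ i) y) {..<k}"
    and SG: "S \<subseteq> carrier G"
    and one: "\<And>y. y \<in> S \<Longrightarrow> finprod G (\<lambda>i. (f ^^ i) y) {..<k} = \<one>"
  shows "finprod G (\<lambda>y. y) S = \<one>"
proof (rule free_orbit_induct[OF assms(1-4), where P = "\<lambda>S. finprod G (\<lambda>y. y) S = \<one>"])
  fix y T
  assume orbit: "y \<in> S" "T \<subseteq> S" "(\<lambda>i. (f ^^ i) y) ` {..<k} \<subseteq> S"
    "(\<lambda>i. (f ^^ i) y) ` {..<k} \<inter> T = {}" "finprod G (\<lambda>y. y) T = \<one>"
  have "finite T" using orbit(2) assms(1) by (rule finite_subset)
  then have "finprod G (\<lambda>y. y) ((\<lambda>i. (f ^^ i) y) ` {..<k} \<union> T)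
      = finprod G (\<lambda>y. y) ((\<lambda>i. (f ^^ i) y) ` {..<k}) \<otimes> finprod G (\<lambda>y. y) T"
    using orbit SG by (intro finprod_Un_disjoint) (auto simp: Pi_def)
  also have "finprod G (\<lambda>y. y) ((\<lambda>i. (f ^^ i) y) ` {..<k}) = finprod G (\<lambda>i. (f ^^ i) y) {..<k}"
    using orbit SG inj[of y] by (intro finprod_reindex) auto
  finally show "finprod G (\<lambda>y. y) ((\<lambda>i. (f ^^ i) y) ` {..<k} \<union> T) = \<one>"
    using one[of y] orbit by simp
qed simp_all

lemma funpow_pow:
  "g \<in> carrier G \<Longrightarrow> ((\<lambda>g. g [^] (k::nat)) ^^ i) g = g [^] (k ^ i)"
  by (induction i) (simp_all add: nat_pow_pow mult.commute)

lemma subgroup_pow_card: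
  assumes "subgroup H G" "h \<in> H" shows "h [^] card H = \<one>"
proof -
  interpret S: group "G\<lparr>carrier := H\<rparr>" using assms(1) by (rule subgroup_imp_group)
  have "h [^]\<^bsub>G\<lparr>carrier := H\<rparr>\<^esub> card H = \<one>"
    using S.pow_order_eq_1[of h] assms(2) by (simp add: order_def)
  moreover have one_eq: "\<one>\<^bsub>G\<lparr>carrier := H\<rparr>\<^esub> = \<one>" by simp
  ultimately show ?thesis by (metis nat_pow_consistent)
qed

lemma exists_element_of_prime_order:
  assumes "subgroup H G" "Factorial_Ring.prime r" "r dvd card H"
  shows "\<exists>h\<in>H. h \<noteq> \<one> \<and> h [^] r = \<one>"
proof -
  interpret S: group "G\<lparr>carrier := H\<rparr>" using assms(1) by (rule subgroup_imp_group)
  obtain m where m: "card H = r ^ 1 * m" using assms(3) by auto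
  have "finite H" using finite_subset[OF subgroup.subset[OF assms(1)] finite_carrier] .
  then obtain K where K: "subgroup K (G\<lparr>carrier := H\<rparr>)" "card K = r ^ 1"
    using sylow_thm[OF assms(2) S.is_group, of 1 m] m by (auto simp: order_def)
  have KG: "subgroup K G" using K(1) assms(1) by (rule incl_subgroup[rotated])
  have "K \<subseteq> H" using subgroup.subset[OF K(1)] by simp
  have "K \<noteq> {\<one>}" using K(2) prime_gt_1_nat[OF assms(2)] by auto
  then obtain h where "h \<in> K" "h \<noteq> \<one>" using subgroup.one_closed[OF KG] by blast
  then show ?thesis using subgroup_pow_card[OF KG] K(2) \<open>K \<subseteq> H\<close> by auto
qed

text \<open>Connects the normalization condition, which for \<open>M\<close> is a product in the
  restricted group, with products in \<open>G\<close>.\<close>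

lemma finprod_subgroup:
  assumes H: "subgroup H G" and S: "S \<subseteq> H"
  shows "finprod (G\<lparr>carrier := H\<rparr>) (\<lambda>y. y) S = finprod G (\<lambda>y. y) S"
proof -
  have HG: "H \<subseteq> carrier G" by (rule subgroup.subset[OF H])
  interpret S: comm_group "G\<lparr>carrier := H\<rparr>"
    using subgroup_imp_group[OF H] HG by (intro group.group_comm_groupI) (auto simp: m_comm subset_iff)
  have "finite S" using S finite_subset[OF HG finite_carrier] finite_subset by auto
  then show ?thesis using S
  proof (induction S rule: finite_induct)
    case (insert y S)
    then show ?case using HG by (subst S.finprod_insert, auto, subst finprod_insert) (auto simp: subset_iff)
  qed simp
qed

section \<open>Intersections with cosets\<close>

text \<open>Inversion is itself a power map, so the results on twists apply to it.\<close>

lemma reflect_eq_twist: "reflect f = twist (order G - 1) f"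
proof -
  have "inv u = u [^] (order G - 1)" if u: "u \<in> carrier G" for u
  proof -
    have "u [^] (order G - 1) \<otimes> u = \<one>"
      using u order_pos by (simp add: nat_pow_Suc[symmetric] pow_order_eq_1 del: nat_pow_Suc)
    then show ?thesis using u by (intro inv_equality) auto
  qed
  then show ?thesis by (auto simp: reflect_def twist_def fun_eq_iff)
qed

lemma reflect_conv: "reflect (f \<star> g) = reflect f \<star> reflect g"
proof -
  have "[(order G - 1) * (order G - 1) = 1] (mod order G)"
  proof -
    obtain m where m: "order G = Suc m" using order_pos gr0_conv_Suc by blast
    have "int (m * m) - int 1 = int (Suc m) * (int m - 1)" by (simp add: algebra_simps)
    then have "int (Suc m) dvd int (m * m) - int 1" by simp
    then show ?thesis
      by (simp only: m diff_Suc_1 cong_iff_dvd_diff cong_int_iff[symmetric])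
  qed
  then show ?thesis by (simp only: reflect_eq_twist twist_conv)
qed

text \<open>Modulo a subgroup \<open>A\<close> of order \<open>Q + 1\<close> the multiplier \<open>Q\<^sup>2\<close> acts as \<open>-1\<close>, so the
  image of \<open>D\<close> in the group ring of \<open>G / A\<close> has square \<open>Q\<^sup>2\<close> up to multiples of \<open>G / A\<close>. As the
  group ring modulo \<open>p\<close> is reduced, this image is \<open>Q\<close> times a group element up to such
  multiples.\<close>
lemma coset_structure:
  fixes p r Q :: nat
  assumes D: "difference_set G D ((Q + 1) * (Q\<^sup>2 + 1)) (Q\<^sup>2 + Q + 1) (Q + 1)"
    and p: "Factorial_Ring.prime p" "Q = p ^ r" "r > 0"
    and mult: "\<And>d. d \<in> D \<Longrightarrow> d [^] Q\<^sup>2 \<in> D"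
    and A: "subgroup A G" "card A = Q + 1"
  shows "\<exists>x\<in>carrier G. \<forall>y\<in>carrier G.
    card {d \<in> D. inv y \<otimes> d \<in> A} = (if inv x \<otimes> y \<in> A then Q + 1 else 1)"
proof -
  have DG: "D \<subseteq> carrier G" and kD: "card D = Q\<^sup>2 + Q + 1" and ord: "order G = (Q + 1) * (Q\<^sup>2 + 1)"
    using D by (auto simp: difference_set_def order_def)
  have AG: "A \<subseteq> carrier G" using A(1) by (rule subgroup.subset)
  have fD: "finite D" using finite_subset[OF DG finite_carrier] .
  have Q0: "Q > 0" using p prime_gt_0_nat by simp
  have cop: "coprime p (order G)"
  proof -
    have "p dvd Q" using p by simp
    then have pd: "p dvd Q ^ 3 + Q\<^sup>2 + Q" by (simp add: power2_eq_square power3_eq_cube)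
    have "order G = Q ^ 3 + Q\<^sup>2 + Q + 1"
      unfolding ord by (simp add: power2_eq_square power3_eq_cube algebra_simps)
    then have "\<not> p dvd order G"
      using pd p(1) by (metis dvd_add_right_iff nat_dvd_1_iff_1 not_prime_1)
    then show ?thesis using p(1) by (rule prime_imp_coprime[rotated])
  qed
  \<comment> \<open>The image of \<open>D\<close> in the group ring of G / A, kept as a function on
    \<open>G\<close> that is constant on cosets; its value at \<open>u\<close> is the number
    \<open>c u\<close> of points of \<open>D\<close> in u A.\<close>
  define Y1 where "Y1 = ind D \<star> ind A"
  define J where "J = ind (carrier G)"
  define c where "c u = card {d \<in> D. inv u \<otimes> d \<in> A}" for u
  have symA: "inv u \<otimes> d \<in> A \<longleftrightarrow> inv d \<otimes> u \<in> A" if "u \<in> carrier G" "d \<in> carrier G" for u d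
    using that A(1) by (metis inv_closed inv_inv inv_mult_group subgroup.m_inv_closed)
  have Y1c: "Y1 u = int (c u)" if u: "u \<in> carrier G" for u
  proof -
    have "Y1 u = (\<Sum>d\<in>D. ind A (inv d \<otimes> u))"
      unfolding Y1_def conv_def using u DG by (simp add: sum_ind_mult)
    also have "\<dots> = (\<Sum>d\<in>D. if inv u \<otimes> d \<in> A then 1 else 0)"
      using symA u DG by (intro sum.cong) (auto simp: ind_def)
    finally show ?thesis unfolding c_def by (simp only: card_eq_sum_ind[OF fD])
  qed
  have idx: "u [^] (Q\<^sup>2 + 1) \<in> A" if "u \<in> carrier G" for u
    using A that ord by (intro pow_index_mem) auto
  have copQ: "coprime (Q\<^sup>2) (order G)"
    using cop p(2) by simp
  \<comment> \<open>The power map with exponent Q^2 carries u A into u^(-1) A, because u^(Q^2 + 1)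
    lies in \<open>A\<close>, and it preserves \<open>D\<close>.\<close>
  have c_le: "c u \<le> c (inv u)" if u: "u \<in> carrier G" for u
    unfolding c_def
  proof (rule card_inj_on_le[where f = "\<lambda>d. d [^] Q\<^sup>2"])
    show "inj_on (\<lambda>d. d [^] Q\<^sup>2) {d \<in> D. inv u \<otimes> d \<in> A}"
      by (rule inj_on_subset[OF inj_on_pow[OF copQ]]) (use DG in auto)
    show "(\<lambda>d. d [^] Q\<^sup>2) ` {d \<in> D. inv u \<otimes> d \<in> A} \<subseteq> {d \<in> D. inv (inv u) \<otimes> d \<in> A}"
    proof clarsimp
      fix d assume d: "d \<in> D" "inv u \<otimes> d \<in> A"
      then have [simp]: "d \<in> carrier G" using DG by auto
      have "(inv u \<otimes> d) [^] Q\<^sup>2 \<in> A" using A(1) d by (intro subgroup_pow_closed)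
      then have "u [^] (Q\<^sup>2 + 1) \<otimes> (inv u \<otimes> d) [^] Q\<^sup>2 \<in> A"
        using idx[OF u] A(1) by (intro subgroup.m_closed)
      also have "u [^] (Q\<^sup>2 + 1) \<otimes> (inv u \<otimes> d) [^] Q\<^sup>2
          = u \<otimes> (u [^] Q\<^sup>2 \<otimes> (inv (u [^] Q\<^sup>2) \<otimes> d [^] Q\<^sup>2))"
        using u by (simp add: nat_pow_distrib nat_pow_inv m_ac)
      also have "\<dots> = u \<otimes> d [^] Q\<^sup>2"
        using u by (subst inv_cancel_left(2)) auto
      finally show "d [^] Q\<^sup>2 \<in> D \<and> inv (inv u) \<otimes> d [^] Q\<^sup>2 \<in> A"
        using mult[OF d(1)] u by simp
    qed
  qed (use fD in auto)
  have c_sym: "c (inv u) = c u" if "u \<in> carrier G" for u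
    using c_le[OF that] c_le[of "inv u"] that by simp
  have Y1r: "reflect Y1 = Y1"
  proof
    fix u show "reflect Y1 u = Y1 u"
      using c_sym[of u] Y1c[of u] Y1c[of "inv u"]
      by (cases "u \<in> carrier G") (auto simp: reflect_def Y1_def conv_def)
  qed
  have rA: "reflect (ind A) = ind A"
    using AG A(1) by (auto simp: reflect_def ind_def fun_eq_iff subgroup.m_inv_closed)
       (metis inv_inv subgroup.m_inv_closed)
  define al where "al = int Q + 1"
  have alA: "(ind A \<star> ind A) u = al * ind A u" if u: "u \<in> carrier G" for u
  proof -
    have "(ind A \<star> ind A) u = (\<Sum>a\<in>A. ind A (inv a \<otimes> u))"
      unfolding conv_def using u AG by (simp add: sum_ind_mult)
    also have "\<dots> = (\<Sum>a\<in>A. ind A u)"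
    proof (intro sum.cong refl)
      fix a assume a: "a \<in> A"
      then have [simp]: "a \<in> carrier G" using AG by auto
      have "inv a \<otimes> u \<in> A \<longleftrightarrow> u \<in> A"
        using a u A(1) by (metis \<open>a \<in> carrier G\<close> inv_cancel_left(2) subgroup.m_closed subgroup.m_inv_closed)
      then show "ind A (inv a \<otimes> u) = ind A u" by (simp add: ind_def)
    qed
    finally show ?thesis using A(2) by (simp add: al_def)
  qed
  define k where "k = int (Q\<^sup>2 + Q + 1)"
  define n where "n = int (Q\<^sup>2)"
  have nk: "k = al + n" by (simp add: k_def al_def n_def)
  have sD: "(\<Sum>x\<in>carrier G. ind D x) = k" using DG kD by (simp add: sum_ind k_def)
  have sA: "(\<Sum>x\<in>carrier G. ind A x) = al" using AG A(2) by (simp add: sum_ind al_def)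
  have sJ: "(\<Sum>x\<in>carrier G. J x) = al * (n + 1)"
    unfolding J_def using ord by (simp add: sum_ind al_def n_def order_def algebra_simps)
  have DD: "ind D \<star> reflect (ind D) = (\<lambda>_. al) * J + (\<lambda>_. n) * delta \<one>"
  proof
    fix u show "(ind D \<star> reflect (ind D)) u = ((\<lambda>_. al) * J + (\<lambda>_. n) * delta \<one>) u"
    proof (cases "u \<in> carrier G")
      case True
      then show ?thesis
        using difference_set_conv[OF D True] by (simp add: J_def ind_def delta_def al_def n_def)
    next
      case False
      then have "u \<noteq> \<one>" by auto
      with False show ?thesis by (simp add: conv_def J_def ind_def delta_def)
    qed
  qed
  \<comment> \<open>When the square is expanded, the constant part is al (al^2 - 2k + n + 1), which
    is zero for these parameters. What remains is a multiple of Q^2 supported on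
    \<open>A\<close>.\<close>
  have YY: "((Y1 - J) \<star> (Y1 - J)) u = n * al * ind A u" if u: "u \<in> carrier G" for u
  proof -
    have "Y1 \<star> Y1 = Y1 \<star> reflect Y1" by (simp only: Y1r)
    also have "\<dots> = (ind D \<star> reflect (ind D)) \<star> (ind A \<star> ind A)"
      unfolding Y1_def reflect_conv rA by (simp only: conv_ac)
    also have "\<dots> = (\<lambda>_. al) * (J \<star> (ind A \<star> ind A)) + (\<lambda>_. n) * (delta \<one> \<star> (ind A \<star> ind A))"
      unfolding DD conv_add_left conv_const_left ..
    finally have "(Y1 \<star> Y1) u = al * (J \<star> (ind A \<star> ind A)) u + n * (ind A \<star> ind A) u"
      by simp
    then have 1: "(Y1 \<star> Y1) u = al * (al * al) + n * (al * ind A u)"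
      using u by (simp add: J_def conv_ind_carrier alA sum_distrib_left[symmetric] sA)
    have 2: "(J \<star> Y1) u = k * al"
      using u by (simp add: J_def conv_ind_carrier Y1_def sum_conv sA sD)
    have 3: "(J \<star> J) u = al * (n + 1)"
      using u sJ unfolding J_def by (simp add: conv_ind_carrier)
    have "(Y1 - J) \<star> (Y1 - J) = Y1 \<star> Y1 - J \<star> Y1 - (J \<star> Y1 - J \<star> J)"
      by (simp only: conv_diff_left conv_diff_right conv_comm[of Y1 J])
    then have "((Y1 - J) \<star> (Y1 - J)) u = (Y1 \<star> Y1) u - (J \<star> Y1) u - ((J \<star> Y1) u - (J \<star> J) u)"
      by (simp only: minus_apply)
    also have "\<dots> = n * al * ind A u + al * (al * al - 2 * k + n + 1)"
      unfolding 1 2 3 by (simp add: algebra_simps)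
    also have "al * al - 2 * k + n + 1 = 0"
      by (simp add: al_def k_def n_def power2_eq_square algebra_simps)
    finally show ?thesis by (simp only: mult_zero_right add_0_right)
  qed
  have sq: "of_nat (p ^ (2 * r)) dvd (Y1 - J) \<star> (Y1 - J)"
    unfolding of_nat_dvd_fun_iff
  proof
    fix u show "int (p ^ (2 * r)) dvd ((Y1 - J) \<star> (Y1 - J)) u"
    proof (cases "u \<in> carrier G")
      case True
      have "n = int (p ^ (2 * r))" by (simp add: n_def p(2) power_mult[symmetric] mult.commute)
      then show ?thesis using YY[OF True] by simp
    qed (simp add: conv_def)
  qed
  have Ydvd: "of_nat (p ^ r) dvd Y1 - J"
  proof -
    have "on_group (Y1 - J)"
      unfolding Y1_def J_def by (intro on_group_diff on_group_conv on_group_ind subset_refl)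
    from group_ring_reduced[OF p(1) cop this sq] show ?thesis .
  qed
  have dv: "int Q dvd int (c u) - 1" if "u \<in> carrier G" for u
  proof -
    have "int (p ^ r) dvd (Y1 - J) u"
      using Ydvd unfolding of_nat_dvd_fun_iff ..
    also have "(Y1 - J) u = int (c u) - 1"
      using that by (simp only: minus_apply Y1c) (simp add: J_def ind_def)
    finally show ?thesis by (simp only: p(2))
  qed
  define Z where "Z u = (int (c u) - 1) div int Q" for u
  have Z: "int (c u) = 1 + int Q * Z u" if "u \<in> carrier G" for u
    using dv[OF that] by (simp add: Z_def)
  have YZ: "(Y1 - J) u = int Q * Z u" if "u \<in> carrier G" for u
    using that Z[OF that] Y1c[OF that] by (simp only: minus_apply J_def) (simp add: ind_def)
  have Zsym: "Z (inv u) = Z u" if "u \<in> carrier G" for u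
    using c_sym[OF that] by (simp add: Z_def)
  \<comment> \<open>Since \<open>Z\<close> is invariant under inversion, the coefficient of the
    square at the identity is a sum of squares.\<close>
  have sumZ2: "(\<Sum>u\<in>carrier G. Z u * Z u) = al"
  proof -
    have "((Y1 - J) \<star> (Y1 - J)) \<one> = (\<Sum>u\<in>carrier G. (Y1 - J) u * (Y1 - J) (inv u \<otimes> \<one>))"
      by (simp add: conv_def)
    also have "\<dots> = (\<Sum>u\<in>carrier G. n * (Z u * Z u))"
    proof (intro sum.cong refl)
      fix u assume u: "u \<in> carrier G"
      then have "inv u \<otimes> \<one> = inv u" by simp
      then show "(Y1 - J) u * (Y1 - J) (inv u \<otimes> \<one>) = n * (Z u * Z u)"
        using u by (simp only: YZ inv_closed Zsym) (simp add: n_def power2_eq_square)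
    qed
    finally have "n * (\<Sum>u\<in>carrier G. Z u * Z u) = n * al"
      using YY[of \<one>] A(1) by (simp add: sum_distrib_left ind_def subgroup.one_closed)
    then show ?thesis using Q0 by (simp add: n_def)
  qed
  have sumZ: "(\<Sum>u\<in>carrier G. Z u) = al"
  proof -
    have "int Q * (\<Sum>u\<in>carrier G. Z u) = (\<Sum>u\<in>carrier G. int (c u) - 1)"
      unfolding sum_distrib_left using Z by (intro sum.cong) auto
    also have "\<dots> = (\<Sum>u\<in>carrier G. Y1 u) - (\<Sum>u\<in>carrier G. J u)"
      unfolding sum_subtractf[symmetric] using Y1c by (intro sum.cong) (auto simp: J_def ind_def)
    also have "\<dots> = k * al - al * (n + 1)" by (simp add: Y1_def sum_conv sD sA sJ)
    also have "\<dots> = int Q * al" by (simp add: k_def n_def algebra_simps)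
    finally show ?thesis using Q0 by simp
  qed
  \<comment> \<open>An integer never exceeds its square, so equal sums force every value of
    \<open>Z\<close> to be 0 or 1.\<close>
  have "(\<Sum>u\<in>carrier G. Z u * Z u - Z u) = 0" by (simp add: sum_subtractf sumZ sumZ2)
  moreover have nn: "Z u * Z u - Z u \<ge> 0" for u
    by (cases "Z u \<le> 0") (auto simp: mult_nonpos_nonpos intro: order_trans[of _ 0] mult_le_cancel_left1[THEN iffD2])
  ultimately have "\<forall>u\<in>carrier G. Z u * Z u - Z u = 0"
    by (subst (asm) sum_nonneg_eq_0_iff) auto
  then have Z01: "Z u = 0 \<or> Z u = 1" if "u \<in> carrier G" for u
    using that by (metis diff_eq_diff_eq mult_cancel_left1 right_minus_eq)
  have "int (card {u \<in> carrier G. Z u = 1}) = (\<Sum>u\<in>carrier G. if Z u = 1 then 1 else 0)"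
    by (rule card_eq_sum_ind) simp
  also have "\<dots> = (\<Sum>u\<in>carrier G. Z u)" using Z01 by (intro sum.cong) auto
  finally have cZ: "card {u \<in> carrier G. Z u = 1} = Q + 1" using sumZ by (simp add: al_def)
  then have "{u \<in> carrier G. Z u = 1} \<noteq> {}" by (metis Suc_eq_plus1 card.empty nat.distinct(1))
  then obtain x where x: "x \<in> carrier G" "Z x = 1" by auto
  \<comment> \<open>\<open>Z\<close> is constant on cosets of \<open>A\<close> and takes the value 1
    exactly |A| times, so these points form the single coset x A.\<close>
  have Zco: "Z (x \<otimes> a) = 1" if a: "a \<in> A" for a
  proof -
    have [simp]: "a \<in> carrier G" using a AG by auto
    have "inv (x \<otimes> a) \<otimes> d \<in> A \<longleftrightarrow> inv x \<otimes> d \<in> A" if "d \<in> D" for d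
    proof -
      have [simp]: "d \<in> carrier G" using that DG by auto
      have "inv (x \<otimes> a) \<otimes> d = inv a \<otimes> (inv x \<otimes> d)"
        using x by (simp add: inv_mult m_ac)
      then show ?thesis
        using a A(1) x by (metis \<open>a \<in> carrier G\<close> \<open>d \<in> carrier G\<close> inv_cancel_left(2) inv_closed m_closed
            subgroup.m_closed subgroup.m_inv_closed)
    qed
    then have "c (x \<otimes> a) = c x" unfolding c_def by (metis (no_types, lifting))
    then show ?thesis using x by (simp add: Z_def)
  qed
  have "(\<lambda>a. x \<otimes> a) ` A = {u \<in> carrier G. Z u = 1}"
  proof (rule card_subset_eq)
    show "(\<lambda>a. x \<otimes> a) ` A \<subseteq> {u \<in> carrier G. Z u = 1}" using Zco x AG by auto
    have "inj_on (\<lambda>a. x \<otimes> a) A" using AG x by (intro inj_onI) (metis l_cancel subsetD)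
    then show "card ((\<lambda>a. x \<otimes> a) ` A) = card {u \<in> carrier G. Z u = 1}"
      using cZ A(2) by (simp add: card_image)
  qed simp
  then have Zx: "Z y = (if inv x \<otimes> y \<in> A then 1 else 0)" if y: "y \<in> carrier G" for y
  proof -
    assume img: "(\<lambda>a. x \<otimes> a) ` A = {u \<in> carrier G. Z u = 1}"
    have "inv x \<otimes> y \<in> A \<longleftrightarrow> y \<in> (\<lambda>a. x \<otimes> a) ` A"
    proof
      assume "inv x \<otimes> y \<in> A"
      then have "x \<otimes> (inv x \<otimes> y) \<in> (\<lambda>a. x \<otimes> a) ` A" by (rule imageI)
      then show "y \<in> (\<lambda>a. x \<otimes> a) ` A" using x y by simp
    next
      assume "y \<in> (\<lambda>a. x \<otimes> a) ` A"
      then show "inv x \<otimes> y \<in> A" using x AG by auto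
    qed
    then have "inv x \<otimes> y \<in> A \<longleftrightarrow> Z y = 1" using y unfolding img by simp
    then show ?thesis using Z01[OF y] by auto
  qed
  have "c y = (if inv x \<otimes> y \<in> A then Q + 1 else 1)" if "y \<in> carrier G" for y
    using Z[OF that] Zx[OF that] by (simp split: if_splits)
  then show ?thesis using x unfolding c_def by blast
qed

end

section \<open>The fixed group\<close>

text \<open>The parameters are those of points and planes of PG(3,Q). In the classical model the
  cosets of \<open>A\<close> are the lines of a spread, and the plane \<open>D\<close> contains one
  of them, x A, and meets each of the others in a point.\<close>

locale singer_difference_set = finite_comm_group G for G (structure) +
  fixes D A M :: "'a set" and x :: 'a and q s Q :: nat
  assumes q2: "q \<ge> 2" and s: "Factorial_Ring.prime s" "odd s" "q \<le> s" "\<not> s dvd q\<^sup>2 + 1"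
    and Q: "Q = q ^ s"
    and D: "difference_set G D ((Q + 1) * (Q\<^sup>2 + 1)) (Q\<^sup>2 + Q + 1) (Q + 1)"
    and mult: "d \<in> D \<Longrightarrow> d [^] q \<in> D"
    and A: "subgroup A G" "card A = Q + 1"
    and M: "subgroup M G" "card M = (q + 1) * (q\<^sup>2 + 1)"
    and x [simp]: "x \<in> carrier G"
    and coset: "y \<in> carrier G \<Longrightarrow>
      card {d \<in> D. inv y \<otimes> d \<in> A} = (if inv x \<otimes> y \<in> A then Q + 1 else 1)"
begin

definition same :: "'a \<Rightarrow> 'a \<Rightarrow> bool" where "same y z \<longleftrightarrow> inv y \<otimes> z \<in> A"

definition F :: "'a set" where "F = {g \<in> carrier G. g [^] (q ^ 4) = g}"

lemma D_carrier: "D \<subseteq> carrier G" and card_D: "card D = Q\<^sup>2 + Q + 1"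
  and order: "order G = (Q + 1) * (Q\<^sup>2 + 1)"
  using D by (auto simp: difference_set_def order_def)

lemma finite_D: "finite D"
  using finite_subset[OF D_carrier finite_carrier] .

lemma D_in [simp]: "d \<in> D \<Longrightarrow> d \<in> carrier G"
  using D_carrier by auto

lemma A_in [simp]: "a \<in> A \<Longrightarrow> a \<in> carrier G"
  using subgroup.subset[OF A(1)] by auto

lemma Q_gt: "Q > q"
proof -
  have "s \<ge> 2" using s(1) by (rule prime_ge_2_nat)
  then have "q ^ 1 < q ^ s" using q2 by (intro power_strict_increasing) auto
  then show ?thesis by (simp add: Q)
qed

lemma coprime_q: "coprime q (order G)"
proof -
  have "q dvd Q" using s(1) prime_gt_0_nat by (simp add: Q)
  then have "q dvd Q * (Q\<^sup>2 + Q + 1)" by simp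
  moreover have "order G = Q * (Q\<^sup>2 + Q + 1) + 1"
    unfolding order by (simp add: power2_eq_square algebra_simps)
  ultimately show ?thesis
    using coprime_divisors[of q "Q * (Q\<^sup>2 + Q + 1)" "order G" "order G"] by simp
qed

text \<open>Gives the \<open>Q\<close>-power map period 4 and, as (q^4)^s = Q^4, the q^4-power map
  period \<open>s\<close>.\<close>

lemma pow_Q4: "g \<in> carrier G \<Longrightarrow> g [^] (Q ^ 4) = g"
proof -
  assume g: "g \<in> carrier G"
  have "int (Q ^ 4) - int 1 = int (order G) * (int Q - 1)"
    unfolding order by (simp add: power2_eq_square power4_eq_xxxx algebra_simps)
  then have "[Q ^ 4 = 1] (mod order G)"
    unfolding cong_int_iff[symmetric] cong_iff_dvd_diff by simp
  then show ?thesis using pow_cong_order[OF g] g by force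
qed

lemma D_pow: "d \<in> D \<Longrightarrow> d [^] (q ^ j) \<in> D"
proof (induction j)
  case (Suc j)
  then have "(d [^] (q ^ j)) [^] q \<in> D" by (intro mult)
  then show ?case using Suc.prems by (simp add: nat_pow_pow mult.commute)
qed simp

lemma D_pow_Q: "d \<in> D \<Longrightarrow> d [^] (Q ^ j) \<in> D"
  using D_pow[of d "s * j"] by (simp add: Q power_mult)

section \<open>Cosets of \<open>A\<close> and their intersections with \<open>D\<close>\<close>

lemma same_refl [simp]: "y \<in> carrier G \<Longrightarrow> same y y"
  using A(1) by (simp add: same_def subgroup.one_closed)

lemma same_sym: "y \<in> carrier G \<Longrightarrow> z \<in> carrier G \<Longrightarrow> same y z \<Longrightarrow> same z y"
  unfolding same_def using A(1) by (metis inv_closed inv_inv inv_mult_group subgroup.m_inv_closed)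

lemma same_trans:
  assumes "y \<in> carrier G" "z \<in> carrier G" "u \<in> carrier G" "same y z" "same z u"
  shows "same y u"
proof -
  have "inv y \<otimes> z \<otimes> (inv z \<otimes> u) \<in> A"
    by (rule subgroup.m_closed[OF A(1) assms(4,5)[unfolded same_def]])
  then show ?thesis using assms by (simp add: same_def m_assoc)
qed

lemma same_pow:
  assumes "y \<in> carrier G" "z \<in> carrier G" "same y z"
  shows "same (y [^] (n::nat)) (z [^] n)"
proof -
  have "(inv y \<otimes> z) [^] n \<in> A"
    using assms A(1) unfolding same_def by (intro subgroup_pow_closed)
  then show ?thesis using assms by (simp add: same_def nat_pow_distrib nat_pow_inv)
qed

lemma same_mult_left:
  assumes "g \<in> carrier G" "y \<in> carrier G" "z \<in> carrier G"
  shows "same (g \<otimes> y) (g \<otimes> z) \<longleftrightarrow> same y z"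
proof -
  have "inv (g \<otimes> y) \<otimes> (g \<otimes> z) = inv y \<otimes> z"
    using assms by (simp add: inv_mult_group m_assoc)
  then show ?thesis by (simp add: same_def)
qed

lemma same_translate:
  assumes "g \<in> carrier G" "y \<in> carrier G"
  shows "same y (g \<otimes> y) \<longleftrightarrow> g \<in> A"
proof -
  have "inv y \<otimes> (g \<otimes> y) = g" using assms by (simp add: m_comm[of g y])
  then show ?thesis by (simp add: same_def)
qed

lemma card_coset:
  assumes H: "subgroup H G" and y: "y \<in> H"
  shows "card {z \<in> H. same y z} = card (A \<inter> H)"
proof -
  note HG = subgroup.subset[OF H]
  have [simp]: "y \<in> carrier G" using y HG by auto
  show ?thesis
  proof (rule bij_betw_same_card[of "\<lambda>z. inv y \<otimes> z"],
      rule bij_betw_byWitness[where f' = "\<lambda>a. y \<otimes> a"])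
    show "\<forall>z\<in>{z \<in> H. same y z}. y \<otimes> (inv y \<otimes> z) = z" using HG by auto
    show "\<forall>a\<in>A \<inter> H. inv y \<otimes> (y \<otimes> a) = a" using HG by auto
    show "(\<lambda>z. inv y \<otimes> z) ` {z \<in> H. same y z} \<subseteq> A \<inter> H"
      using y H by (auto simp: same_def subgroup.m_closed subgroup.m_inv_closed)
    show "(\<lambda>a. y \<otimes> a) ` (A \<inter> H) \<subseteq> {z \<in> H. same y z}"
      using y H by (auto simp: same_def subgroup.m_closed)
  qed
qed

lemma card_same_D: "y \<in> carrier G \<Longrightarrow> card {d \<in> D. same y d} = (if same x y then Q + 1 else 1)"
  unfolding same_def by (rule coset)

lemma full_coset:
  assumes "y \<in> carrier G" "same x y" shows "y \<in> D"
proof -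
  have "A \<inter> carrier G = A" by auto
  then have "card {z \<in> carrier G. same x z} = Q + 1"
    using card_coset[OF subgroup_self x] A(2) by simp
  moreover have "card {d \<in> D. same x d} = Q + 1" using card_same_D[of x] by simp
  ultimately have "{d \<in> D. same x d} = {z \<in> carrier G. same x z}"
    by (intro card_subset_eq) auto
  then show ?thesis using assms by blast
qed

lemma coset_unique:
  assumes "d1 \<in> D" "d2 \<in> D" "same d1 d2" "\<not> same x d1"
  shows "d1 = d2"
proof -
  have "card {d \<in> D. same d1 d} = 1" using assms card_same_D[of d1] by simp
  then obtain d where d: "{d \<in> D. same d1 d} = {d}" by (rule card_1_singletonE)
  have "d1 \<in> {d}" "d2 \<in> {d}" unfolding d[symmetric] using assms by auto
  then show ?thesis by simp
qed

lemma coset_meets: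
  assumes "y \<in> carrier G" obtains d where "d \<in> D" "same y d"
proof -
  have "card {d \<in> D. same y d} \<noteq> 0" using card_same_D[OF assms] by simp
  then have "{d \<in> D. same y d} \<noteq> {}" by (metis card.empty)
  then show thesis using that by auto
qed

lemma pow_index_A: "y \<in> carrier G \<Longrightarrow> y [^] (Q\<^sup>2 + 1) \<in> A"
  using A order by (intro pow_index_mem) auto

text \<open>The \<open>q\<close>-power map is injective on x A and stays in \<open>D\<close>, so the
  coset it reaches holds more than one point of \<open>D\<close> and must be x A. Hence x^(q-1), and
  so x^(Q^2-1), lies in \<open>A\<close>; comparison with x^(Q^2+1) leaves x^2.\<close>

lemma x_square: "x \<otimes> x \<in> A"
proof -
  have "same x (x [^] q)"
  proof (rule ccontr)
    assume "\<not> same x (x [^] q)"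
    have "A \<noteq> {\<one>}" using A(2) Q_gt by auto
    then obtain a where a: "a \<in> A" "a \<noteq> \<one>" using subgroup.one_closed[OF A(1)] by blast
    have xa: "same x (x \<otimes> a)" using a by (simp add: same_def)
    have "x [^] q \<in> D" "(x \<otimes> a) [^] q \<in> D"
      using xa a by (auto intro!: mult full_coset)
    moreover have "same (x [^] q) ((x \<otimes> a) [^] q)" using xa a by (intro same_pow) auto
    ultimately have "x [^] q = (x \<otimes> a) [^] q"
      using \<open>\<not> same x (x [^] q)\<close> by (intro coset_unique)
    then have "x = x \<otimes> a" using inj_on_pow[OF coprime_q] a by (auto dest: inj_onD)
    then show False using a by simp
  qed
  moreover have "inv x \<otimes> x [^] q = x [^] (q - 1)"
  proof -
    have "x [^] q = x \<otimes> x [^] (q - 1)" using q2 by (cases q) (simp_all only: nat_pow_Suc2 x, simp_all)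
    then show ?thesis by simp
  qed
  ultimately have "x [^] (q - 1) \<in> A" by (simp add: same_def)
  moreover obtain c where c: "Q\<^sup>2 - 1 = (q - 1) * c"
    using minus_one_dvd_power_minus_one[of q "s * 2"] q2 by (auto simp: Q power_mult dvd_def)
  ultimately have "x [^] (Q\<^sup>2 - 1) \<in> A"
    unfolding c using A(1) by (simp add: nat_pow_pow[symmetric] subgroup_pow_closed)
  then have "inv (x [^] (Q\<^sup>2 - 1)) \<otimes> x [^] (Q\<^sup>2 + 1) \<in> A"
    using A(1) pow_index_A[OF x] by (intro subgroup.m_closed subgroup.m_inv_closed)
  also have "x [^] (Q\<^sup>2 + 1) = x [^] (Q\<^sup>2 - 1) \<otimes> (x \<otimes> x)"
  proof -
    have "Q\<^sup>2 + 1 = (Q\<^sup>2 - 1) + Suc (Suc 0)" using Q_gt by simp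
    then have "x [^] (Q\<^sup>2 + 1) = x [^] (Q\<^sup>2 - 1) \<otimes> x [^] Suc (Suc 0)"
      by (simp only: nat_pow_mult x)
    then show ?thesis by simp
  qed
  finally show ?thesis by simp
qed

lemma square_pow: "y \<in> carrier G \<Longrightarrow> y [^] (2 * j) = (y \<otimes> y) [^] (j::nat)"
  by (subst nat_pow_pow[symmetric]) (simp_all add: numeral_2_eq_2)

lemma same_odd_pow:
  fixes n :: nat
  assumes "y \<in> carrier G" "y \<otimes> y \<in> A" "odd n"
  shows "same y (y [^] n)"
proof -
  obtain j where "n = 2 * j + 1" using assms(3) by (rule oddE)
  then have "y [^] n = y \<otimes> (y \<otimes> y) [^] j" using assms(1) by (simp add: square_pow m_comm)
  then have "inv y \<otimes> y [^] n = (y \<otimes> y) [^] j" using assms(1) by simp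
  then show ?thesis using assms A(1) by (simp add: same_def subgroup_pow_closed)
qed

text \<open>For even \<open>q\<close> the quotient by \<open>A\<close> has odd order Q^2 + 1, so it
  contains no involution.\<close>

lemma square_even:
  assumes "y \<in> carrier G" "y \<otimes> y \<in> A" "even q"
  shows "y \<in> A"
proof -
  have "even (Q\<^sup>2)" using assms(3) s(1) prime_gt_0_nat by (simp add: Q)
  then have "same y (y [^] (Q\<^sup>2 + 1))" using assms by (intro same_odd_pow) auto
  then have "same (y [^] (Q\<^sup>2 + 1)) y"
    by (rule same_sym[OF assms(1) nat_pow_closed[OF assms(1)]])
  then have "inv (y [^] (Q\<^sup>2 + 1)) \<otimes> y \<in> A" by (simp only: same_def)
  then have "y [^] (Q\<^sup>2 + 1) \<otimes> (inv (y [^] (Q\<^sup>2 + 1)) \<otimes> y) \<in> A"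
    by (rule subgroup.m_closed[OF A(1) pow_index_A[OF assms(1)]])
  then show ?thesis using inv_cancel_left(2)[OF nat_pow_closed[OF assms(1)] assms(1)] by metis
qed

lemma same_q_pow:
  assumes "y \<in> carrier G" "y \<otimes> y \<in> A"
  shows "same y (y [^] (q ^ j))"
proof (cases "even q")
  case True
  then have "y \<in> A" using assms square_even by blast
  then show ?thesis using A(1) by (simp add: same_def subgroup_pow_closed subgroup.m_closed subgroup.m_inv_closed)
next
  case False
  then show ?thesis using assms by (intro same_odd_pow) auto
qed

section \<open>Cofactors of q + 1 and q^2 + 1\<close>

lemma Q_factor: obtains w where "Q + 1 = (q + 1) * w" "odd w"
  using odd_power_plus_one[OF s(2), of q] q2 by (auto simp: Q)

text \<open>The cofactor is congruent to \<open>s\<close> modulo q^2 + 1, so the assumption that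
  \<open>s\<close> does not divide q^2 + 1 makes it coprime to that number. With coprimality to q^2
  - 1 this covers q^4 - 1, an exponent of \<open>F\<close>.\<close>

lemma Q2_factor: obtains w where "Q\<^sup>2 + 1 = (q\<^sup>2 + 1) * w" "odd w" "coprime w (q ^ 4 - 1)"
proof -
  obtain w where w: "(q\<^sup>2) ^ s + 1 = (q\<^sup>2 + 1) * w" "odd w" "coprime w (q\<^sup>2 - 1)" "[w = s] (mod (q\<^sup>2 + 1))"
    using odd_power_plus_one[OF s(2), of "q\<^sup>2"] q2 by auto
  have "coprime s (q\<^sup>2 + 1)" using s(1,4) by (rule prime_imp_coprime)
  then have "coprime w (q\<^sup>2 + 1)" using w(4) by (metis cong_imp_coprime cong_sym)
  then have "coprime w ((q\<^sup>2 - 1) * (q\<^sup>2 + 1))" using w(3) by (simp only: coprime_mult_right_iff)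
  moreover have "(q\<^sup>2 - 1) * (q\<^sup>2 + 1) = q ^ 4 - 1"
    by (simp add: power4_eq_xxxx power2_eq_square algebra_simps)
  moreover have "(q\<^sup>2) ^ s = Q\<^sup>2" by (simp add: Q power_mult[symmetric] mult.commute)
  ultimately show thesis using that w by simp
qed

section \<open>The fixed group of the q^4-power map\<close>

lemma F_carrier: "F \<subseteq> carrier G"
  by (auto simp: F_def)

lemma F_in: "g \<in> F \<Longrightarrow> g \<in> carrier G"
  by (simp add: F_def)

lemma F_subgroup: "subgroup F G"
proof (rule subgroupI)
  show "F \<noteq> {}" by (auto simp: F_def intro: exI[of _ \<one>])
qed (auto simp: F_def nat_pow_distrib nat_pow_inv)

lemma F_I:
  assumes "g \<in> carrier G" "g [^] ((q + 1) * (q\<^sup>2 + 1)) = \<one>"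
  shows "g \<in> F"
proof -
  have "int (q ^ 4) = int ((q + 1) * (q\<^sup>2 + 1) * (q - 1) + 1)"
    using q2 by (simp add: of_nat_diff power4_eq_xxxx power2_eq_square algebra_simps)
  then have "q ^ 4 = (q + 1) * (q\<^sup>2 + 1) * (q - 1) + 1" by (simp only: of_nat_eq_iff)
  then have "g [^] (q ^ 4) = g [^] ((q + 1) * (q\<^sup>2 + 1) * (q - 1)) \<otimes> g [^] (1 :: nat)"
    by (simp only: nat_pow_mult[OF assms(1)])
  also have "g [^] ((q + 1) * (q\<^sup>2 + 1) * (q - 1)) = \<one>"
    by (rule pow_eq_one_dvd[OF assms dvd_triv_left])
  finally show ?thesis using assms(1) by (simp add: F_def)
qed

lemma M_subset_F: "M \<subseteq> F"
  using subgroup_pow_card[OF M(1)] M(2) subgroup.subset[OF M(1)] by (auto intro!: F_I)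

text \<open>The exponent w1 w2 is |G| / ((q + 1)(q^2 + 1)), which moves \<open>x\<close> into
  \<open>F\<close>. It is odd, so the power stays in x A because x^2 lies in
  \<open>A\<close>.\<close>

lemma z_exists: obtains z where "z \<in> F" "same x z"
proof -
  obtain w1 where w1: "Q + 1 = (q + 1) * w1" "odd w1" by (rule Q_factor)
  obtain w2 where w2: "Q\<^sup>2 + 1 = (q\<^sup>2 + 1) * w2" "odd w2" by (rule Q2_factor)
  have "order G = w1 * w2 * ((q + 1) * (q\<^sup>2 + 1))" unfolding order w1(1) w2(1) by (simp only: mult_ac)
  then have "(x [^] (w1 * w2)) [^] ((q + 1) * (q\<^sup>2 + 1)) = \<one>"
    using pow_order_eq_1[OF x] by (simp only: nat_pow_pow x)
  then have "x [^] (w1 * w2) \<in> F" by (intro F_I) auto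
  moreover have "same x (x [^] (w1 * w2))" using x_square w1 w2 by (intro same_odd_pow) auto
  ultimately show thesis using that by blast
qed

text \<open>The q^4-th power of \<open>d\<close> is again a point of \<open>D\<close> in a coset
  that holds only one.\<close>

lemma fixed_D:
  assumes "d \<in> D" "\<not> same x d" "same d (d [^] (q ^ 4))"
  shows "d \<in> F"
  using coset_unique[OF assms(1) D_pow[OF assms(1)] assms(3,2), symmetric] assms(1)
  unfolding F_def by simp


section \<open>Counting representations inside the fixed group\<close>

definition E :: "'a set" where "E = D \<inter> F"

definition a :: nat where "a = card (A \<inter> F)"

lemma finite_F: "finite F"
  using finite_subset[OF F_carrier finite_carrier] .

lemma finite_E: "finite E"
  using finite_F by (simp add: E_def)

lemma E_in: "d \<in> E \<Longrightarrow> d \<in> D \<and> d \<in> F \<and> d \<in> carrier G"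
  by (auto simp: E_def)

lemma card_same_F: "y \<in> F \<Longrightarrow> card {d \<in> F. same y d} = a"
  unfolding a_def by (rule card_coset[OF F_subgroup])

lemma card_same_x_F: "card {d \<in> F. same x d} = a"
proof -
  obtain z where z: "z \<in> F" "same x z" by (rule z_exists)
  have zG: "z \<in> carrier G" using z F_in by blast
  have "{d \<in> F. same x d} = {d \<in> F. same z d}"
    using z zG F_in same_trans[OF x zG] same_trans[OF zG x] same_sym[OF x zG] by blast
  then show ?thesis using card_same_F[OF z(1)] by simp
qed

lemma same_x_E: "{d \<in> E. same x d} = {d \<in> F. same x d}"
  using full_coset F_in by (auto simp: E_def)

text \<open>The q^4-power map preserves the coset of a fixed \<open>y\<close>, hence fixes the
  unique point of \<open>D\<close> in it.\<close>

lemma meets_E: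
  assumes y: "y \<in> F" "\<not> same x y"
  obtains d where "d \<in> E" "same y d" "\<not> same x d"
proof -
  have yG: "y \<in> carrier G" "y [^] (q ^ 4) = y" using y by (auto simp: F_def)
  obtain d where d: "d \<in> D" "same y d" using coset_meets[OF yG(1)] by blast
  have dG: "d \<in> carrier G" using d by simp
  have nx: "\<not> same x d"
    using y(2) same_trans[OF x dG yG(1)] same_sym[OF yG(1) dG d(2)] by blast
  have "same y (d [^] (q ^ 4))" using same_pow[OF yG(1) dG d(2), of "q ^ 4"] yG(2) by simp
  then have "same d (d [^] (q ^ 4))"
    using same_trans[OF dG yG(1) nat_pow_closed[OF dG]] same_sym[OF yG(1) dG d(2)] by blast
  then have "d \<in> F" using fixed_D d(1) nx by blast
  then show thesis using that d nx by (simp add: E_def)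
qed

lemma card_same_E:
  assumes y: "y \<in> F"
  shows "card {d \<in> E. same y d} = (if same x y then a else 1)"
proof (cases "same x y")
  case True
  have yG: "y \<in> carrier G" using y F_in by blast
  have "{d \<in> E. same y d} = {d \<in> F. same y d}"
    using full_coset F_in same_trans[OF x yG _ True] by (auto simp: E_def)
  then show ?thesis using True card_same_F[OF y] by simp
next
  case False
  have yG: "y \<in> carrier G" using y F_in by blast
  obtain d where d: "d \<in> E" "same y d" "\<not> same x d" using meets_E[OF y False] .
  have dG: "d \<in> carrier G" using d E_in by blast
  have "{d \<in> E. same y d} = {d}"
  proof (intro Set.equalityI subsetI)
    fix d' assume d': "d' \<in> {d \<in> E. same y d}"
    then have "same d d'"
      using same_trans[OF dG yG] same_sym[OF yG dG d(2)] E_in by blast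
    then show "d' \<in> {d}" using coset_unique[of d d'] d d' by (simp add: E_def)
  qed (use d in auto)
  then show ?thesis using False by simp
qed

text \<open>Double count of the pairs in E x F lying in a common coset of \<open>A\<close>. With |F|
  = a b it yields |E| = a + b - 1.\<close>

lemma card_E_times: "card E * a + a = a * a + card F"
proof -
  have "card E * a = (\<Sum>d\<in>E. card {y \<in> F. same y d})"
  proof -
    have "{y \<in> F. same y d} = {y \<in> F. same d y}" if "d \<in> E" for d
      using that E_in F_in same_sym by blast
    then show ?thesis using card_same_F E_in by simp
  qed
  also have "\<dots> = (\<Sum>d\<in>E. \<Sum>y\<in>F. if same y d then 1 else 0)"
    using finite_F by (simp add: sum.If_cases Int_def)
  also have "\<dots> = (\<Sum>y\<in>F. \<Sum>d\<in>E. if same y d then 1 else 0)"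
    by (rule sum.swap)
  also have "\<dots> = (\<Sum>y\<in>F. card {d \<in> E. same y d})"
    using finite_E by (simp add: sum.If_cases Int_def)
  also have "\<dots> = (\<Sum>y\<in>F. if same x y then a else 1)"
    using card_same_E by simp
  also have "\<dots> = a * card {y \<in> F. same x y} + card {y \<in> F. \<not> same x y}"
    using finite_F by (simp add: sum.If_cases Int_def)
  also have "\<dots> = a * a + card {y \<in> F. \<not> same x y}" by (simp add: card_same_x_F)
  finally have "card E * a = a * a + card {y \<in> F. \<not> same x y}" .
  moreover have "card F = card {y \<in> F. same x y} + card {y \<in> F. \<not> same x y}"
    using finite_F by (subst card_Un_disjoint[symmetric]) (auto intro!: arg_cong[where f = card])
  ultimately show ?thesis using card_same_x_F by simp
qed

text \<open>The number of representations of \<open>g\<close> as a quotient of two elements of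
  \<open>E\<close>, indexed by the denominator.\<close>

definition reps :: "'a \<Rightarrow> nat" where "reps g = card {d \<in> E. g \<otimes> d \<in> E}"

lemma F_mult: "g \<in> F \<Longrightarrow> h \<in> F \<Longrightarrow> g \<otimes> h \<in> F"
  by (rule subgroup.m_closed[OF F_subgroup])

lemma F_mult_iff:
  assumes "g \<in> F" "d \<in> carrier G"
  shows "g \<otimes> d \<in> F \<longleftrightarrow> d \<in> F"
proof
  assume "g \<otimes> d \<in> F"
  then have "inv g \<otimes> (g \<otimes> d) \<in> F"
    by (rule F_mult[OF subgroup.m_inv_closed[OF F_subgroup assms(1)]])
  then show "d \<in> F" using assms F_in by simp
qed (rule F_mult[OF assms(1)])

text \<open>Translation by an element of \<open>A\<close> preserves every coset. It moves the single
  point of \<open>D\<close> in an ordinary coset out of \<open>D\<close>, whereas it permutes x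
  A.\<close>

lemma reps_A:
  assumes g: "g \<in> F" "g \<in> A" "g \<noteq> \<one>"
  shows "reps g = a"
proof -
  have gG: "g \<in> carrier G" using g by simp
  have "d \<in> E \<and> g \<otimes> d \<in> E \<longleftrightarrow> d \<in> E \<and> same x d" for d
  proof (cases "d \<in> E")
    case True
    then have d: "d \<in> D" "d \<in> F" "d \<in> carrier G" using E_in by auto
    have sm: "same d (g \<otimes> d)" using same_translate[OF gG d(3)] g by simp
    have "same x d" if "g \<otimes> d \<in> D"
    proof (rule ccontr)
      assume "\<not> same x d"
      then have "d = g \<otimes> d" using coset_unique[OF d(1) that sm] by blast
      then have "g = \<one>" using gG d(3) by (metis l_one one_closed r_cancel)
      then show False using g by simp
    qed
    moreover have "g \<otimes> d \<in> D" if "same x d"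
      using full_coset same_trans[OF x d(3) _ that sm] gG d(3) by simp
    ultimately show ?thesis using True F_mult[OF g(1) d(2)] by (auto simp: E_def)
  qed simp
  then show ?thesis unfolding reps_def using same_x_E card_same_x_F by simp
qed

text \<open>As \<open>g\<close> moves x A to another coset, one representation starts in x A and
  ends at the point of \<open>E\<close> in g x A; another starts at the point of \<open>E\<close> in
  g^(-1) x A and ends in x A.\<close>

lemma reps_ge_2:
  assumes g: "g \<in> F" "g \<notin> A"
  shows "reps g \<ge> 2"
proof -
  have gG: "g \<in> carrier G" using g F_in by blast
  obtain z where z: "z \<in> F" "same x z" by (rule z_exists)
  have zG: "z \<in> carrier G" using z F_in by blast
  have n1: "\<not> same x (g \<otimes> z)"
  proof
    assume "same x (g \<otimes> z)"
    then have "same z (g \<otimes> z)"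
      using same_trans[OF zG x] same_sym[OF x zG z(2)] gG zG by simp
    then show False using same_translate[OF gG zG] g by simp
  qed
  obtain d1 where d1: "d1 \<in> E" "same (g \<otimes> z) d1" "\<not> same x d1"
    using meets_E[OF F_mult[OF g(1) z(1)] n1] .
  have d1G: "d1 \<in> carrier G" using d1 E_in by blast
  define e1 where "e1 = inv g \<otimes> d1"
  have e1G: "e1 \<in> carrier G" using gG d1G by (simp add: e1_def)
  have ge1: "g \<otimes> e1 = d1" using gG d1G by (simp add: e1_def)
  have "same z e1" using d1(2) same_mult_left[OF gG zG e1G] by (simp add: ge1)
  then have xe1: "same x e1" using same_trans[OF x zG e1G z(2)] by simp
  have "e1 \<in> F" using F_mult_iff[OF g(1) e1G] d1 E_in ge1 by auto
  then have e1: "e1 \<in> E" "g \<otimes> e1 \<in> E"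
    using full_coset[OF e1G xe1] d1 ge1 by (auto simp: E_def)
  define y where "y = inv g \<otimes> z"
  have yF: "y \<in> F" unfolding y_def by (rule F_mult[OF subgroup.m_inv_closed[OF F_subgroup g(1)] z(1)])
  have yG: "y \<in> carrier G" using yF F_in by blast
  have gy: "g \<otimes> y = z" using gG zG by (simp add: y_def)
  have n2: "\<not> same x y"
  proof
    assume "same x y"
    then have "same y z" using same_trans[OF yG x zG] same_sym[OF x yG] z(2) by simp
    then show False using same_translate[OF gG yG] g by (simp add: gy)
  qed
  obtain d2 where d2: "d2 \<in> E" "same y d2" "\<not> same x d2" using meets_E[OF yF n2] .
  have d2G: "d2 \<in> carrier G" using d2 E_in by blast
  have "same z (g \<otimes> d2)" using d2(2) same_mult_left[OF gG yG d2G] by (simp add: gy)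
  then have "same x (g \<otimes> d2)" using same_trans[OF x zG _ z(2)] gG d2G by simp
  then have "g \<otimes> d2 \<in> D" using full_coset gG d2G by simp
  moreover have "g \<otimes> d2 \<in> F" using F_mult[OF g(1)] d2 E_in by blast
  ultimately have "g \<otimes> d2 \<in> E" by (simp add: E_def)
  moreover have "e1 \<noteq> d2" using xe1 d2(3) by auto
  ultimately have "card {e1, d2} = 2" "{e1, d2} \<subseteq> {d \<in> E. g \<otimes> d \<in> E}" using e1 d2 by auto
  then show ?thesis
    unfolding reps_def using card_mono[of "{d \<in> E. g \<otimes> d \<in> E}" "{e1, d2}"] finite_E by simp
qed

text \<open>Because \<open>g\<close> is fixed, the q^4-power map permutes the Q + 1 representations
  of \<open>g\<close> from \<open>D\<close> with period \<open>s\<close>, and the fixed ones are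
  those from \<open>E\<close>. Fermat gives Q = q^s congruent to \<open>q\<close>.\<close>

lemma reps_cong:
  assumes g: "g \<in> F" "g \<noteq> \<one>"
  shows "[reps g = q + 1] (mod s)"
proof -
  have gG: "g \<in> carrier G" and gq: "g [^] (q ^ 4) = g" using g by (auto simp: F_def)
  define S where "S = {d \<in> D. g \<otimes> d \<in> D}"
  define f where "f = (\<lambda>d. d [^] (q ^ 4))"
  have "card S = Q + 1"
    using D g gG difference_set_iff[OF D_carrier] by (simp add: S_def)
  moreover have "[card S = card {d \<in> S. f d = d}] (mod s)"
  proof (rule card_fixed_points_cong[OF s(1)])
    show "finite S" using finite_D by (simp add: S_def)
    fix d assume d: "d \<in> S"
    then have dG: "d \<in> carrier G" by (simp add: S_def)
    have "(g \<otimes> d) [^] (q ^ 4) = g \<otimes> f d"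
      by (simp only: nat_pow_distrib[OF gG dG] gq f_def)
    then show "f d \<in> S" using d D_pow[of d 4] D_pow[of "g \<otimes> d" 4] by (simp add: S_def f_def)
    have "(q ^ 4) ^ s = Q ^ 4" by (simp add: Q power_mult[symmetric] mult.commute)
    then show "(f ^^ s) d = d" unfolding f_def using funpow_pow[OF dG] pow_Q4[OF dG] by simp
  qed
  moreover have "{d \<in> S. f d = d} = {d \<in> E. g \<otimes> d \<in> E}"
  proof -
    have "f d = d \<longleftrightarrow> d \<in> F" if "d \<in> D" for d using that by (auto simp: f_def F_def)
    then show ?thesis using F_mult_iff[OF g(1)] D_in by (auto simp: S_def E_def)
  qed
  ultimately have "[Q + 1 = reps g] (mod s)" by (simp add: reps_def)
  moreover have "[Q + 1 = q + 1] (mod s)"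
    unfolding Q by (intro cong_add fermat_nat s(1) cong_refl)
  ultimately show ?thesis by (metis cong_sym cong_trans)
qed

text \<open>A value between 2 and \<open>q\<close> would make the prime \<open>s\<close> divide a
  positive number at most q - 1, although s \<ge> q.\<close>

lemma reps_ge:
  assumes g: "g \<in> F" "g \<notin> A"
  shows "reps g \<ge> q + 1"
proof (rule ccontr)
  assume "\<not> reps g \<ge> q + 1"
  have "g \<noteq> \<one>" using g subgroup.one_closed[OF A(1)] by auto
  then have "[reps g = q + 1] (mod s)" using reps_cong g by blast
  then have "[int (q + 1) = int (reps g)] (mod int s)" by (simp only: cong_int_iff cong_sym)
  then have "int s dvd int (q + 1) - int (reps g)" by (simp only: cong_iff_dvd_diff)
  moreover have "0 < int (q + 1) - int (reps g)" using \<open>\<not> reps g \<ge> q + 1\<close> by simp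
  ultimately have "int s \<le> int (q + 1) - int (reps g)" by (rule zdvd_imp_le)
  then show False using reps_ge_2[OF g] s(3) by simp
qed

lemma sum_reps: "(\<Sum>g\<in>F. reps g) = card E * card E"
proof -
  have "(\<Sum>g\<in>F. reps g) = (\<Sum>g\<in>F. \<Sum>d\<in>E. if g \<otimes> d \<in> E then 1 else 0)"
    unfolding reps_def using finite_E by (simp add: sum.If_cases Int_def)
  also have "\<dots> = (\<Sum>d\<in>E. \<Sum>g\<in>F. if g \<otimes> d \<in> E then 1 else 0)" by (rule sum.swap)
  also have "\<dots> = (\<Sum>d\<in>E. card {g \<in> F. g \<otimes> d \<in> E})"
    using finite_F by (simp add: sum.If_cases Int_def)
  also have "\<dots> = (\<Sum>d\<in>E. card E)"
  proof (intro sum.cong refl)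
    fix d assume d: "d \<in> E"
    then have dF: "d \<in> F" "d \<in> carrier G" using E_in by auto
    show "card {g \<in> F. g \<otimes> d \<in> E} = card E"
    proof (rule bij_betw_same_card[of "\<lambda>g. g \<otimes> d"],
        rule bij_betw_byWitness[where f' = "\<lambda>e. e \<otimes> inv d"])
      show "\<forall>g\<in>{g \<in> F. g \<otimes> d \<in> E}. g \<otimes> d \<otimes> inv d = g"
        using dF F_in by (auto simp: m_assoc)
      show "\<forall>e\<in>E. e \<otimes> inv d \<otimes> d = e" using dF E_in by (auto simp: m_assoc)
      show "(\<lambda>g. g \<otimes> d) ` {g \<in> F. g \<otimes> d \<in> E} \<subseteq> E" by auto
      show "(\<lambda>e. e \<otimes> inv d) ` E \<subseteq> {g \<in> F. g \<otimes> d \<in> E}"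
        using dF E_in F_mult subgroup.m_inv_closed[OF F_subgroup] by (auto simp: m_assoc)
    qed
  qed
  finally show ?thesis by simp
qed

text \<open>With b = |F| / a, the pairs of elements of \<open>E\<close> not accounted for by F
  \<inter> A are distributed over \<open>F - A\<close>, each element of which needs at least q + 1.
  The divisibility bound on \<open>b\<close> leaves room only for equality.\<close>

lemma fixed_counts: "card F = (q + 1) * (q\<^sup>2 + 1)" "a = q + 1"
  "\<forall>g\<in>F - A. reps g = q + 1" "card E = q\<^sup>2 + q + 1"
proof -
  obtain b where b: "card F = a * b"
    using card_Int_dvd[OF F_subgroup A(1)] by (auto simp: a_def Int_commute dvd_def)
  have F1: "\<one> \<in> F" by (rule subgroup.one_closed[OF F_subgroup])
  have Fpos: "card F > 0" using F1 finite_F by (auto simp: card_gt_0_iff)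
  then have ab: "a > 0" "b > 0" using b by auto
  have Qf: "card M dvd card F"
    using card_Int_dvd[OF F_subgroup M(1)] M_subset_F by (simp add: Int_absorb1)
  \<comment> \<open>The subgroup generated by \<open>F\<close> and \<open>A\<close> has order b (Q +
    1), which divides the order of \<open>G\<close>.\<close>
  have b_dvd: "b dvd Q\<^sup>2 + 1"
  proof -
    have "card (F <#> A) * a = card F * (Q + 1)"
      using card_set_mult[OF F_subgroup A(1)] A(2) by (simp add: a_def Int_commute)
    then have "a * card (F <#> A) = a * (b * (Q + 1))" by (simp only: b mult_ac)
    then have "card (F <#> A) = b * (Q + 1)" using ab by simp
    then have "b * (Q + 1) dvd (Q\<^sup>2 + 1) * (Q + 1)"
      using subgroup_card_dvd[OF mult_subgroups[OF F_subgroup A(1)]] order by (simp add: mult.commute)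
    then show ?thesis using dvd_times_right_cancel_iff[of "Q + 1" b "Q\<^sup>2 + 1"] by simp
  qed
  obtain w where w: "Q\<^sup>2 + 1 = (q\<^sup>2 + 1) * w" "coprime w (q ^ 4 - 1)" by (rule Q2_factor)
  \<comment> \<open>A common prime would be the order of some element of \<open>F\<close>, where q^4
    - 1 is an exponent, contradicting that \<open>w\<close> is coprime to q^4 - 1.\<close>
  have "coprime b w"
  proof (rule ccontr)
    assume "\<not> coprime b w"
    then have "gcd b w \<noteq> 1" by (simp only: coprime_iff_gcd_eq_1 not_False_eq_True)
    then obtain r where r: "Factorial_Ring.prime r" "r dvd gcd b w" using prime_factor_nat by blast
    then have rbw: "r dvd b" "r dvd w" by simp_all
    then have "r dvd card F" by (simp add: b)
    then obtain h where h: "h \<in> F" "h \<noteq> \<one>" "h [^] r = \<one>"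
      using exists_element_of_prime_order[OF F_subgroup r(1)] by blast
    have hG: "h \<in> carrier G" "h [^] (q ^ 4) = h" using h by (auto simp: F_def)
    have "q ^ 4 = Suc (q ^ 4 - 1)" using q2 by simp
    then have "h [^] (q ^ 4) = h [^] (q ^ 4 - 1) \<otimes> h" by (metis nat_pow_Suc)
    then have "h [^] (q ^ 4 - 1) \<otimes> h = \<one> \<otimes> h" using hG by simp
    then have "h [^] (q ^ 4 - 1) = \<one>" using hG(1) by (metis nat_pow_closed one_closed r_cancel)
    then have "h [^] gcd r (q ^ 4 - 1) = \<one>" using pow_eq_one_gcd[OF hG(1) h(3)] by blast
    moreover have "gcd r (q ^ 4 - 1) = 1"
      using coprime_divisors[OF rbw(2) dvd_refl w(2)] by (simp only: coprime_iff_gcd_eq_1)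
    ultimately show False using h(2) hG(1) by simp
  qed
  then have "b dvd q\<^sup>2 + 1"
    using b_dvd unfolding w(1) by (simp only: coprime_dvd_mult_left_iff)
  then have b_le: "b \<le> q\<^sup>2 + 1" by (rule dvd_imp_le) simp
  have b2: "b \<ge> 2"
  proof (rule ccontr)
    assume "\<not> b \<ge> 2"
    then have "b = 1" using ab by simp
    then have "A \<inter> F = F" using b finite_F by (intro card_subset_eq) (auto simp: a_def)
    then have "M \<subseteq> A" using M_subset_F by auto
    then have "card M dvd card A" using card_Int_dvd[OF A(1) M(1)] by (simp add: Int_absorb1)
    then have "q\<^sup>2 + 1 dvd Q + 1" unfolding M(2) A(2) by (rule dvd_mult_right)
    then have "int (q\<^sup>2 + 1) dvd int (Q + 1) * (int Q - 1)" by (simp only: int_dvd_int_iff dvd_mult2)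
    moreover have "int (q\<^sup>2 + 1) dvd int (Q\<^sup>2 + 1)"
      by (simp only: w(1) int_dvd_int_iff dvd_triv_left)
    \<comment> \<open>If \<open>b\<close> were 1, then \<open>M\<close> would lie in
      \<open>A\<close> and q^2 + 1 would divide both Q + 1 and Q^2 + 1, hence (Q^2 + 1) - (Q + 1)(Q
      - 1) = 2.\<close>
    ultimately have "int (q\<^sup>2 + 1) dvd int (Q\<^sup>2 + 1) - int (Q + 1) * (int Q - 1)"
      by (rule dvd_diff[rotated])
    then have "int (q\<^sup>2 + 1) dvd 2" by (simp add: power2_eq_square algebra_simps)
    then have "int (q\<^sup>2 + 1) \<le> 2" by (rule zdvd_imp_le) simp
    then have "q\<^sup>2 + 1 \<le> 2" by linarith
    moreover have "2\<^sup>2 \<le> q\<^sup>2" using q2 by (rule power_mono) simp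
    ultimately show False by simp
  qed
  have "(card E + 1) * a = (a + b) * a"
    using card_E_times b by (simp add: algebra_simps)
  then have "card E + 1 = a + b" using ab(1) by (metis mult_cancel2 not_gr_zero)
  then have m: "card E = a + b - 1" by simp
  let ?R = "(\<Sum>g\<in>F - A. reps g)"
  have A1: "\<one> \<in> A" by (rule subgroup.one_closed[OF A(1)])
  have reps1: "reps \<one> = card E"
    unfolding reps_def using E_in by (intro arg_cong[where f = card]) auto
  have cardFA: "card (F - A) = a * (b - 1)"
    using finite_F b by (simp add: card_Diff_subset_Int a_def Int_commute right_diff_distrib')
  have "card E * card E = card E + (a - 1) * a + ?R"
  proof -
    have "(\<Sum>g\<in>F. reps g) = reps \<one> + (\<Sum>g\<in>F - {\<one>}. reps g)"
      using finite_F F1 by (simp add: sum.remove)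
    also have "F - {\<one>} = (A \<inter> F - {\<one>}) \<union> (F - A)" using A1 by auto
    also have "(\<Sum>g\<in>(A \<inter> F - {\<one>}) \<union> (F - A). reps g) = (\<Sum>g\<in>A \<inter> F - {\<one>}. reps g) + ?R"
      using finite_F by (intro sum.union_disjoint) auto
    also have "(\<Sum>g\<in>A \<inter> F - {\<one>}. reps g) = (\<Sum>g\<in>A \<inter> F - {\<one>}. a)"
      by (intro sum.cong refl reps_A) auto
    also have "\<dots> = (a - 1) * a" using A1 F1 finite_F by (simp add: a_def)
    finally show ?thesis using reps1 sum_reps by simp
  qed
  \<comment> \<open>This is |E|^2 - |E| - a(a - 1) for |E| = a + b - 1; both numbers are written as
    successors to avoid truncated subtraction.\<close>
  then have R: "?R = (b - 1) * (2 * a + b - 2)"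
  proof -
    obtain a' where a': "a = Suc a'" using ab gr0_conv_Suc by blast
    obtain b' where b': "b = Suc b'" using ab gr0_conv_Suc by blast
    assume eq: "card E * card E = card E + (a - 1) * a + ?R"
    have "card E = Suc (a' + b')" using m by (simp add: a' b')
    then show ?thesis using eq by (simp add: a' b' algebra_simps)
  qed
  have R_ge: "(b - 1) * (a * (q + 1)) \<le> ?R"
  proof -
    have "(\<Sum>g\<in>F - A. q + 1) \<le> ?R" using reps_ge by (intro sum_mono) auto
    then show ?thesis by (simp only: sum_constant cardFA of_nat_id mult_ac)
  qed
  have "(q + 1) * (q\<^sup>2 + 1) \<le> a * b"
    using dvd_imp_le[OF Qf Fpos] M(2) b by simp
  note count = count_bound[OF q2 b_le b2 this R_ge[unfolded R]]
  show aq: "a = q + 1" by (rule count(1))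
  have bq: "b = q\<^sup>2 + 1" by (rule count(2))
  show "card F = (q + 1) * (q\<^sup>2 + 1)" unfolding b aq bq ..
  show "card E = q\<^sup>2 + q + 1" unfolding m aq bq by simp
  \<comment> \<open>The total equals |F - A| times the lower bound, so no single term can exceed
    it.\<close>
  show "\<forall>g\<in>F - A. reps g = q + 1"
  proof (rule ccontr)
    assume "\<not> ?thesis"
    then obtain g where g: "g \<in> F - A" "reps g \<noteq> q + 1" by blast
    then have "reps g > q + 1" using reps_ge[of g] by auto
    then have "(\<Sum>g\<in>F - A. q + 1) < ?R"
      using g(1) reps_ge finite_F by (intro sum_strict_mono_ex1) auto
    moreover have "?R = (\<Sum>g\<in>F - A. q + 1)"
    proof -
      have "2 * a + b - 2 = a * (q + 1)" unfolding aq bq by (simp add: power2_eq_square)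
      then show ?thesis unfolding R by (simp only: sum_constant cardFA of_nat_id mult_ac)
    qed
    ultimately show False by simp
  qed
qed

lemma F_eq_M: "F = M"
  using card_subset_eq[OF finite_F M_subset_F] fixed_counts(1) M(2) by simp

lemma reps_eq:
  assumes "g \<in> M" "g \<noteq> \<one>"
  shows "reps g = q + 1"
  using assms fixed_counts(2,3) reps_A by (cases "g \<in> A") (auto simp: F_eq_M)

section \<open>The product over the part of \<open>D\<close> outside \<open>M\<close>\<close>

lemma finprod_A_minus_M: "finprod G (\<lambda>y. y) (A - M) = \<one>"
proof (rule finprod_free_orbits[where f = "\<lambda>y. inv y" and k = 2])
  show "finite (A - M)"
    using finite_subset[OF subgroup.subset[OF A(1)] finite_carrier] by simp
  fix y assume y: "y \<in> A - M"
  then have yG: "y \<in> carrier G" by simp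
  have "inv y \<notin> M" using y yG subgroup.m_inv_closed[OF M(1), of "inv y"] by auto
  then show "inv y \<in> A - M" using y subgroup.m_inv_closed[OF A(1)] by simp
  show per: "((\<lambda>y. inv y) ^^ 2) y = y" using yG by (simp add: numeral_2_eq_2)
  have "inv y \<noteq> y"
  proof
    assume "inv y = y"
    then have "y \<otimes> y = \<one>" using yG by (metis r_inv)
    then have y2: "y [^] (2::nat) = \<one>" using yG by (simp add: numeral_2_eq_2)
    \<comment> \<open>Inversion can only fix elements with square 1. For even \<open>q\<close> the
      order of \<open>A\<close> is odd and only the identity remains; for odd \<open>q\<close> such
      elements lie in \<open>F\<close> because (q + 1)(q^2 + 1) is even.\<close>
    have "y \<in> F"
    proof (cases "even q")
      case True
      then have "odd (Q + 1)" using s(1) prime_gt_0_nat by (simp add: Q)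
      then have "gcd 2 (Q + 1) = 1" by (simp flip: coprime_iff_gcd_eq_1)
      moreover have "y [^] (Q + 1) = \<one>" using subgroup_pow_card[OF A(1)] A(2) y by force
      ultimately have "y = \<one>" using pow_eq_one_gcd[OF yG y2, of "Q + 1"] yG by simp
      then show ?thesis using subgroup.one_closed[OF F_subgroup] by simp
    next
      case False
      then have "even ((q + 1) * (q\<^sup>2 + 1))" by simp
      then show ?thesis by (rule F_I[OF yG pow_eq_one_dvd[OF yG y2]])
    qed
    then show False using y by (simp add: F_eq_M)
  qed
  then show "inj_on (\<lambda>i. ((\<lambda>y. inv y) ^^ i) y) {..<2}"
    by (intro inj_on_orbit[OF per]) (metis One_nat_def funpow_0 funpow_simps_right(2) less_2_cases o_apply less_numeral_extra(3))
  have "{..<2::nat} = {0, 1}" by auto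
  then show "finprod G (\<lambda>i. ((\<lambda>y. inv y) ^^ i) y) {..<2} = \<one>"
    using yG by simp
qed (use s in auto)


definition C :: "'a set" where "C = {y \<in> carrier G. same x y}"

lemma C_D: "C \<subseteq> D"
  using full_coset by (auto simp: C_def)

text \<open>Translation by a point \<open>z\<close> of x A in \<open>M\<close> reduces the product
  to that over \<open>A - M\<close> times z^(Q - q), and (q + 1)(q - 1) divides Q - q.\<close>

lemma finprod_C_minus_M: "finprod G (\<lambda>y. y) (C - M) = \<one>"
proof -
  obtain z where z: "z \<in> F" "same x z" by (rule z_exists)
  have zG: "z \<in> carrier G" and zM: "z \<in> M" using z F_in F_eq_M by auto
  have AM: "subgroup (A \<inter> M) G" using A(1) M(1) by (rule subgroups_Inter_pair)
  have cAM: "card (A \<inter> M) = q + 1" using fixed_counts(2) by (simp add: a_def F_eq_M)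
  have finA: "finite A" using finite_subset[OF subgroup.subset[OF A(1)] finite_carrier] .
  have img: "C - M = (\<lambda>a. z \<otimes> a) ` (A - M)"
  proof (intro Set.equalityI subsetI)
    fix y assume y: "y \<in> C - M"
    then have yG: "y \<in> carrier G" by (simp add: C_def)
    have "same z y" using y same_trans[OF zG x yG] same_sym[OF x zG z(2)] by (simp add: C_def)
    then have "inv z \<otimes> y \<in> A" by (simp add: same_def)
    moreover have "inv z \<otimes> y \<notin> M"
    proof
      assume "inv z \<otimes> y \<in> M"
      then have "z \<otimes> (inv z \<otimes> y) \<in> M" by (rule subgroup.m_closed[OF M(1) zM])
      then show False using y zG yG by simp
    qed
    ultimately have "z \<otimes> (inv z \<otimes> y) \<in> (\<lambda>a. z \<otimes> a) ` (A - M)" by (intro imageI) simp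
    then show "y \<in> (\<lambda>a. z \<otimes> a) ` (A - M)" using zG yG by simp
  next
    fix y assume "y \<in> (\<lambda>a. z \<otimes> a) ` (A - M)"
    then obtain a where a: "a \<in> A" "a \<notin> M" "y = z \<otimes> a" by auto
    have aG: "a \<in> carrier G" using a by simp
    have "same z y" using a zG by (simp add: same_def)
    then have "y \<in> C" using same_trans[OF x zG _ z(2)] a zG by (simp add: C_def)
    moreover have "y \<notin> M"
      using F_mult_iff[OF z(1) aG] a by (simp add: F_eq_M)
    ultimately show "y \<in> C - M" by simp
  qed
  have "inj_on (\<lambda>a. z \<otimes> a) (A - M)" using zG by (intro inj_onI) auto
  then have "finprod G (\<lambda>y. y) (C - M) = finprod G (\<lambda>a. z \<otimes> a) (A - M)"
    unfolding img using zG by (subst finprod_reindex) auto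
  also have "\<dots> = z [^] card (A - M)"
    using zG finprod_A_minus_M by (subst finprod_multf) (auto simp: finprod_const)
  also have "card (A - M) = Q - q"
    using finA A(2) cAM by (simp add: card_Diff_subset_Int)
  also have "z [^] (Q - q) = \<one>"
  proof -
    obtain j where j: "s = Suc (2 * j)" using s(2) by (metis oddE Suc_eq_plus1)
    have "Q - q = q * ((q\<^sup>2) ^ j - 1)"
      unfolding Q j by (simp add: power_mult right_diff_distrib')
    moreover have "q\<^sup>2 - 1 dvd (q\<^sup>2) ^ j - 1"
      using q2 by (intro minus_one_dvd_power_minus_one) simp
    moreover have "q\<^sup>2 - 1 = (q + 1) * (q - 1)"
      by (simp add: power2_eq_square right_diff_distrib')
    ultimately have dv: "(q + 1) * (q - 1) dvd Q - q" by simp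
    have zz: "z \<otimes> z \<in> A"
    proof -
      have "inv x \<otimes> z \<in> A" using z by (simp add: same_def)
      then have "(x \<otimes> x) \<otimes> ((inv x \<otimes> z) \<otimes> (inv x \<otimes> z)) \<in> A"
        using A(1) x_square subgroup.m_closed[OF A(1)] by simp
      also have "(x \<otimes> x) \<otimes> ((inv x \<otimes> z) \<otimes> (inv x \<otimes> z)) = (x \<otimes> (inv x \<otimes> z)) \<otimes> (x \<otimes> (inv x \<otimes> z))"
        using zG by (simp only: m_ac inv_closed m_closed x)
      also have "\<dots> = z \<otimes> z" using zG by simp
      finally show ?thesis .
    qed
    show ?thesis
    \<comment> \<open>For even \<open>q\<close>, \<open>z\<close> itself lies in the group
      \<open>A \<inter> M\<close> of order q + 1. For odd \<open>q\<close> only its square does, and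
      the missing factor 2 comes from q - 1.\<close>
    proof (cases "even q")
      case True
      then have "z \<in> A \<inter> M" using square_even[OF zG zz] zM by simp
      then have "z [^] (q + 1) = \<one>" using subgroup_pow_card[OF AM] cAM by metis
      then show ?thesis by (rule pow_eq_one_dvd[OF zG _ dvd_mult_left[OF dv]])
    next
      case False
      have "z \<otimes> z \<in> A \<inter> M" using zz zM subgroup.m_closed[OF M(1)] by simp
      then have "(z \<otimes> z) [^] (q + 1) = \<one>" using subgroup_pow_card[OF AM] cAM by metis
      then have "z [^] (2 * (q + 1)) = \<one>" using square_pow[OF zG] by metis
      moreover have "2 * (q + 1) dvd Q - q"
      proof -
        have "2 dvd q - 1" using False by simp
        then have "(q + 1) * 2 dvd (q + 1) * (q - 1)" by (rule mult_dvd_mono[OF dvd_refl])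
        then have "(q + 1) * 2 dvd Q - q" using dv by (rule dvd_trans)
        then show ?thesis by (simp only: mult.commute)
      qed
      ultimately show ?thesis by (rule pow_eq_one_dvd[OF zG])
    qed
  qed
  finally show ?thesis .
qed

lemma same_x_Q_pow: "same x (x [^] (Q ^ j))"
  using same_q_pow[OF x x_square, of "s * j"] by (simp add: Q power_mult)

lemma Q_pow_inverse:
  assumes "y \<in> carrier G" shows "(y [^] Q) [^] (Q ^ 3) = y"
proof -
  have "Q * Q ^ 3 = Q ^ 4" by (simp add: power3_eq_cube power4_eq_xxxx)
  then show ?thesis using pow_Q4[OF assms] by (simp only: nat_pow_pow[OF assms])
qed

lemma finprod_rest: "finprod G (\<lambda>y. y) (D - M - C) = \<one>"
proof (rule finprod_free_orbits[where f = "\<lambda>y. y [^] Q" and k = 4])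
  show "finite (D - M - C)" using finite_D by simp
  fix d assume d: "d \<in> D - M - C"
  then have dG: "d \<in> carrier G" by simp
  have nx: "\<not> same x d" using d by (auto simp: C_def)
  show "d [^] Q \<in> D - M - C"
  proof -
    have "d [^] Q \<in> D" using D_pow_Q[of d 1] d by simp
    moreover have "d [^] Q \<notin> M"
    proof
      assume "d [^] Q \<in> M"
      then have "(d [^] Q) [^] (Q ^ 3) \<in> M" by (rule subgroup_pow_closed[OF M(1)])
      then show False using d Q_pow_inverse[OF dG] by simp
    qed
    moreover have "\<not> same x (d [^] Q)"
    proof
      assume "same x (d [^] Q)"
      then have "same (x [^] (Q ^ 3)) ((d [^] Q) [^] (Q ^ 3))"
        by (rule same_pow[OF x nat_pow_closed[OF dG]])
      then have "same (x [^] (Q ^ 3)) d" by (simp only: Q_pow_inverse[OF dG])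
      then show False using nx same_trans[OF x nat_pow_closed[OF x] dG same_x_Q_pow] by blast
    qed
    ultimately show ?thesis by (simp add: C_def)
  qed
  show per: "((\<lambda>y. y [^] Q) ^^ 4) d = d" using funpow_pow[OF dG] pow_Q4[OF dG] by simp
  show "inj_on (\<lambda>i. ((\<lambda>y. y [^] Q) ^^ i) d) {..<4}"
  proof (rule inj_on_orbit[OF per])
    fix i :: nat assume i: "0 < i" "i < 4"
    show "((\<lambda>y. y [^] Q) ^^ i) d \<noteq> d"
    proof
      assume "((\<lambda>y. y [^] Q) ^^ i) d = d"
      then have "((\<lambda>y. y [^] Q) ^^ 2) d = d" using funpow_four_fixed[OF per] i by blast
      then have dQ: "d [^] Q\<^sup>2 = d" using funpow_pow[OF dG] by simp
      \<comment> \<open>If the exponent Q^2 fixed \<open>d\<close>, then d^2 = d^(Q^2 + 1) would lie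
        in \<open>A\<close>; the coset of \<open>d\<close> would be preserved by the q^4-power map,
        putting \<open>d\<close> in \<open>F\<close>.\<close>
      have "d \<otimes> d \<in> A" using pow_index_A[OF dG] dQ by simp
      then have "d \<in> F" using d by (intro fixed_D[OF _ nx same_q_pow[OF dG]]) auto
      then show False using d by (simp add: F_eq_M)
    qed
  qed
  have four: "{..<4::nat} = {0, 1, 2, 3}" by auto
  have "finprod G (\<lambda>i. ((\<lambda>y. y [^] Q) ^^ i) d) {..<4} = finprod G (\<lambda>i. d [^] (Q ^ i)) {..<4}"
    using dG by (intro finprod_cong') (auto simp: funpow_pow)
  also have "\<dots> = d [^] (Q ^ 0) \<otimes> (d [^] (Q ^ 1) \<otimes> (d [^] (Q ^ 2) \<otimes> d [^] (Q ^ 3)))"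
    unfolding four using dG by (simp add: finprod_insert)
  also have "\<dots> = d [^] (Q ^ 0 + (Q ^ 1 + (Q ^ 2 + Q ^ 3)))"
    by (simp only: nat_pow_mult dG)
  also have "Q ^ 0 + (Q ^ 1 + (Q ^ 2 + Q ^ 3)) = order G"
    unfolding order by (simp add: power2_eq_square power3_eq_cube algebra_simps)
  finally show "finprod G (\<lambda>i. ((\<lambda>y. y [^] Q) ^^ i) d) {..<4} = \<one>"
    using pow_order_eq_1[OF dG] by simp
qed (use D_carrier in auto)

lemma finprod_D_Int_M: "finprod G (\<lambda>y. y) (D \<inter> M) = finprod G (\<lambda>y. y) D"
proof -
  have MG: "M \<subseteq> carrier G" by (rule subgroup.subset[OF M(1)])
  have CG: "C \<subseteq> carrier G" by (auto simp: C_def)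
  have "D = (D \<inter> M) \<union> ((C - M) \<union> (D - M - C))" using C_D by auto
  then have "finprod G (\<lambda>y. y) D = finprod G (\<lambda>y. y) ((D \<inter> M) \<union> ((C - M) \<union> (D - M - C)))" by simp
  also have "\<dots> = finprod G (\<lambda>y. y) (D \<inter> M) \<otimes>
      (finprod G (\<lambda>y. y) (C - M) \<otimes> finprod G (\<lambda>y. y) (D - M - C))"
    using finite_D finite_subset[OF CG finite_carrier] MG CG
    by (subst finprod_Un_disjoint; (subst finprod_Un_disjoint)?) (auto simp: subset_iff)
  finally show ?thesis
    using MG by (simp add: finprod_C_minus_M finprod_rest Pi_def)
qed

section \<open>Restriction of the difference set to \<open>M\<close>\<close>

lemma normalized_restriction:
  assumes "finprod G (\<lambda>d. d) D = \<one>"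
  shows "normalized_difference_set (G\<lparr>carrier := M\<rparr>) (D \<inter> M) ((q + 1) * (q\<^sup>2 + 1)) (q\<^sup>2 + q + 1) (q + 1)"
proof -
  have MG: "M \<subseteq> carrier G" by (rule subgroup.subset[OF M(1)])
  have E: "E = D \<inter> M" by (simp add: E_def F_eq_M)
  have "card {(d1, d2). d1 \<in> D \<inter> M \<and> d2 \<in> D \<inter> M \<and>
      d1 \<otimes>\<^bsub>G\<lparr>carrier := M\<rparr>\<^esub> inv\<^bsub>G\<lparr>carrier := M\<rparr>\<^esub> d2 = g} = q + 1" if g: "g \<in> M" "g \<noteq> \<one>" for g
  proof -
    have "{(d1, d2). d1 \<in> D \<inter> M \<and> d2 \<in> D \<inter> M \<and>
        d1 \<otimes>\<^bsub>G\<lparr>carrier := M\<rparr>\<^esub> inv\<^bsub>G\<lparr>carrier := M\<rparr>\<^esub> d2 = g}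
      = {(d1, d2). d1 \<in> E \<and> d2 \<in> E \<and> d1 \<otimes> inv d2 = g}"
      using m_inv_consistent[OF M(1)] by (auto simp: E)
    then show ?thesis
      using card_differences[of E E g] g MG E_in reps_eq[OF g] by (auto simp: reps_def)
  qed
  then show ?thesis
    using M(2) fixed_counts(4) assms finprod_D_Int_M finprod_subgroup[OF M(1), of "D \<inter> M"]
    by (simp add: normalized_difference_set_def difference_set_def E)
qed

end

theorem theorem4p3:
  fixes G :: "('a, 'b) monoid_scheme" and D M :: "'a set" and q s :: nat
  assumes "prime_power q"
    and "Factorial_Ring.prime s" and "odd s" and "s \<ge> q" and "\<not> s dvd q ^ 2 + 1"
    and "comm_group G"
    and "card (carrier G) = (q ^ s + 1) * (q ^ (2 * s) + 1)"
    and "normalized_difference_set G D ((q ^ s + 1) * (q ^ (2 * s) + 1))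
           (q ^ (2 * s) + q ^ s + 1) (q ^ s + 1)"
    and "subgroup M G"
    and "card M = (q + 1) * (q ^ 2 + 1)"
  shows "normalized_difference_set (G\<lparr>carrier := M\<rparr>) (D \<inter> M)
           ((q + 1) * (q ^ 2 + 1)) (q ^ 2 + q + 1) (q + 1)"
proof -
  define Q where "Q = q ^ s"
  have Q2: "q ^ (2 * s) = Q\<^sup>2" by (simp add: Q_def power_mult[symmetric] mult.commute)
  interpret comm_group G by fact
  interpret finite_comm_group G
  proof
    have "card (carrier G) > 0" unfolding assms(7) by simp
    then show "finite (carrier G)" by (rule card_ge_0_finite)
  qed
  obtain p n where p: "Factorial_Ring.prime p" "n \<ge> 1" "q = p ^ n"
    using assms(1) by (auto simp: prime_power_def)
  have q2: "q \<ge> 2" using p prime_ge_2_nat[OF p(1)] self_le_power[of p n] by simp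
  have s3: "s > 0" using assms(2) by (rule prime_gt_0_nat)
  have nD: "normalized_difference_set G D ((Q + 1) * (Q\<^sup>2 + 1)) (Q\<^sup>2 + Q + 1) (Q + 1)"
    using assms(8) unfolding Q2 Q_def .
  then have DS: "difference_set G D ((Q + 1) * (Q\<^sup>2 + 1)) (Q\<^sup>2 + Q + 1) (Q + 1)"
    and D1: "finprod G (\<lambda>d. d) D = \<one>\<^bsub>G\<^esub>"
    by (auto simp: normalized_difference_set_def)
  have Qp: "Q = p ^ (n * s)" by (simp add: Q_def p(3) power_mult)
  have ord: "order G = (Q + 1) * (Q\<^sup>2 + 1)" using DS by (simp add: difference_set_def order_def)
  \<comment> \<open>The group order is Q k + 1, so divisors of Q and of k are coprime to it.\<close>
  have v: "(Q + 1) * (Q\<^sup>2 + 1) = Suc (Q * (Q\<^sup>2 + Q + 1))"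
    by (simp add: power2_eq_square algebra_simps)
  have copv: "coprime p ((Q + 1) * (Q\<^sup>2 + 1))"
  proof -
    have "p dvd Q" using p(2) s3 by (simp add: Qp)
    then have "p dvd Q * (Q\<^sup>2 + Q + 1)" by simp
    then show ?thesis unfolding v by (rule coprime_divisors[OF _ dvd_refl]) simp
  qed
  have Q4: "Q \<ge> 4"
  proof -
    have "s \<ge> 2" using assms(2) by (rule prime_ge_2_nat)
    have "2\<^sup>2 \<le> q\<^sup>2" using q2 by (rule power_mono) simp
    also have "q\<^sup>2 \<le> q ^ s" using \<open>s \<ge> 2\<close> q2 by (intro power_increasing) auto
    finally show ?thesis by (simp add: Q_def)
  qed
  \<comment> \<open>Here k - lam = Q^2 is a power of \<open>p\<close>, and it exceeds lam = Q + 1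
    because Q \<ge> 4.\<close>
  have "(\<lambda>d. d [^]\<^bsub>G\<^esub> p) ` D = D"
  proof (rule normalized_prime_multiplier[OF nD p(1) copv])
    show "Q\<^sup>2 + Q + 1 = Q + 1 + p ^ (n * s * 2)" by (simp add: Qp power_mult[symmetric])
    have "4 * Q \<le> Q\<^sup>2" using Q4 by (simp add: power2_eq_square)
    then have "Q + 1 < Q\<^sup>2" using Q4 by linarith
    then show "Q + 1 < p ^ (n * s * 2)" by (simp add: Qp power_mult[symmetric])
    show "coprime (Q\<^sup>2 + Q + 1) ((Q + 1) * (Q\<^sup>2 + 1))"
      unfolding v by (rule coprime_divisors[OF dvd_triv_right[of _ Q] dvd_refl]) simp
  qed
  then have mp: "d [^]\<^bsub>G\<^esub> p \<in> D" if "d \<in> D" for d using that by auto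
  have DG: "d \<in> carrier G" if "d \<in> D" for d using DS that by (auto simp: difference_set_def)
  have mpn: "d [^]\<^bsub>G\<^esub> (p ^ m) \<in> D" if "d \<in> D" for d m
  proof (induction m)
    case (Suc m)
    then have "(d [^]\<^bsub>G\<^esub> (p ^ m)) [^]\<^bsub>G\<^esub> p \<in> D" by (rule mp)
    then show ?case using DG[OF that] by (simp add: nat_pow_pow mult.commute)
  qed (use that DG in simp)
  \<comment> \<open>Any subgroup of this order serves; it exists because \<open>G\<close> is
    abelian.\<close>
  obtain A where A: "subgroup A G" "card A = Q + 1"
  proof -
    have "Q + 1 dvd order G" unfolding ord by (rule dvd_triv_left)
    then show ?thesis using exists_subgroup_of_order that by blast
  qed
  have "\<exists>x\<in>carrier G. \<forall>y\<in>carrier G.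
    card {d \<in> D. inv\<^bsub>G\<^esub> y \<otimes>\<^bsub>G\<^esub> d \<in> A} = (if inv\<^bsub>G\<^esub> x \<otimes>\<^bsub>G\<^esub> y \<in> A then Q + 1 else 1)"
  proof (rule coset_structure[OF DS p(1) Qp _ _ A])
    show "n * s > 0" using p(2) s3 by simp
    show "d [^]\<^bsub>G\<^esub> Q\<^sup>2 \<in> D" if "d \<in> D" for d
      using mpn[OF that, of "n * s * 2"] by (simp add: Qp power_mult)
  qed
  then obtain x where x: "x \<in> carrier G" "\<And>y. y \<in> carrier G \<Longrightarrow>
    card {d \<in> D. inv\<^bsub>G\<^esub> y \<otimes>\<^bsub>G\<^esub> d \<in> A} = (if inv\<^bsub>G\<^esub> x \<otimes>\<^bsub>G\<^esub> y \<in> A then Q + 1 else 1)" by blast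
  interpret singer_difference_set G D A M x q s Q
  proof (rule singer_difference_set.intro[OF finite_comm_group_axioms],
      rule singer_difference_set_axioms.intro)
    show "d [^]\<^bsub>G\<^esub> q \<in> D" if "d \<in> D" for d using mpn[OF that, of n] by (simp add: p(3))
  qed (fact q2 assms(2-5,9,10) Q_def DS A x)+
  show ?thesis using normalized_restriction[OF D1] .
qed

end
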